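(* \textsc{Max-Min Fair Matching} with the non-emptiness constraint can be solved in $O^{\star}(2^{2^{O(k)}})$ time, where $k=|V|$ is the number of vertices on the right side of the input bipartite graph.
   Context: Let $G=(U\cup V,E)$ be a bipartite graph with left side $U$ and right side $V$ ($U\cap V=\emptyset$); write $n=|U|$ and $k=|V|$. For a vertex $w$ and $M\subseteq E$, let $M(w)=\{w' \mid \{w,w'\}\in M\}$. A many-to-one matching is a set $M\subseteq E$ with $|M(u)|\le 1$ for every $u\in U$; it is left-perfect if $|M(u)|=1$ for every $u\in U$. Let $C$ be a finite set of colors and $\mathrm{col}\colon U\to C$; for $U'\subseteq U$ and $c\in C$ let $U'_c=\{u\in U'\mid \mathrm{col}(u)=c\}$. Define $\mathrm{MaxMin}(U')=\max_{c\in C}|U'_c|-\min_{c\in C}|U'_c|$ (over all colors of $C$). For an integer $\ell\ge 0$, $U'$ is $\ell$-fair if $\mathrm{MaxMin}(U')\le\ell$, and $M$ is $\ell$-fair if $M(v)$ is $\ell$-fair for every $v\in V$. \textsc{Max-Min Fair Matching} with the non-emptiness constraint: given $G$, $C$, $\mathrm{col}$ and $\ell\in\mathbb{N}$, decide whether there is a left-perfect many-to-one matching $M$ in $G$ that is $\ell$-fair and satisfies $M(v)\neq\emptyset$ for every $v\in V$. The notation $O^{\star}(\cdot)$ suppresses factors polynomial in the input size. *)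

theory Defs
  imports
    Complex_Main
    "HOL-Library.Landau_Symbols"
    "HOL-Computational_Algebra.Polynomial"
begin

section \<open>Fair many-to-one matchings\<close>

definition bipartite_graph :: "'v set \<Rightarrow> 'v set \<Rightarrow> 'v set set \<Rightarrow> bool" where
  "bipartite_graph U V E \<longleftrightarrow>
     finite U \<and> finite V \<and> U \<inter> V = {} \<and> E \<subseteq> {{u, v} | u v. u \<in> U \<and> v \<in> V}"

definition partners :: "'v set set \<Rightarrow> 'v \<Rightarrow> 'v set" where
  "partners M w = {w'. {w, w'} \<in> M}"

definition many_to_one_matching :: "'v set \<Rightarrow> 'v set set \<Rightarrow> 'v set set \<Rightarrow> bool" where
  "many_to_one_matching U E M \<longleftrightarrow> M \<subseteq> E \<and> (\<forall>u\<in>U. card (partners M u) \<le> 1)"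

definition left_perfect :: "'v set \<Rightarrow> 'v set set \<Rightarrow> bool" where
  "left_perfect U M \<longleftrightarrow> (\<forall>u\<in>U. card (partners M u) = 1)"

definition color_class :: "('v \<Rightarrow> 'c) \<Rightarrow> 'v set \<Rightarrow> 'c \<Rightarrow> 'v set" where
  "color_class col U' c = {u \<in> U'. col u = c}"

definition MaxMin :: "'c set \<Rightarrow> ('v \<Rightarrow> 'c) \<Rightarrow> 'v set \<Rightarrow> nat" where
  "MaxMin C col U' =
     Max ((\<lambda>c. card (color_class col U' c)) ` C) - Min ((\<lambda>c. card (color_class col U' c)) ` C)"

definition fair_set :: "'c set \<Rightarrow> ('v \<Rightarrow> 'c) \<Rightarrow> nat \<Rightarrow> 'v set \<Rightarrow> bool" where
  "fair_set C col l U' \<longleftrightarrow> MaxMin C col U' \<le> l"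

definition fair_matching :: "'v set \<Rightarrow> 'c set \<Rightarrow> ('v \<Rightarrow> 'c) \<Rightarrow> nat \<Rightarrow> 'v set set \<Rightarrow> bool" where
  "fair_matching V C col l M \<longleftrightarrow> (\<forall>v\<in>V. fair_set C col l (partners M v))"

record ('v, 'c) fair_instance =
  lefts :: "'v set"
  rights :: "'v set"
  edges :: "'v set set"
  colors :: "'c set"
  coloring :: "'v \<Rightarrow> 'c"
  bound :: nat

text \<open>The set of colors has to be nonempty for the maximum and minimum over all colors to exist.\<close>

definition valid_instance :: "('v, 'c) fair_instance \<Rightarrow> bool" where
  "valid_instance I \<longleftrightarrow>
     bipartite_graph (lefts I) (rights I) (edges I) \<and>
     finite (colors I) \<and> colors I \<noteq> {} \<and> coloring I ` lefts I \<subseteq> colors I"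

definition MaxMin_Fair_Matching_nonempty :: "('v, 'c) fair_instance \<Rightarrow> bool" where
  "MaxMin_Fair_Matching_nonempty I \<longleftrightarrow>
     (\<exists>M. many_to_one_matching (lefts I) (edges I) M \<and>
          left_perfect (lefts I) M \<and>
          fair_matching (rights I) (colors I) (coloring I) (bound I) M \<and>
          (\<forall>v\<in>rights I. partners M v \<noteq> {}))"


section \<open>Model of computation\<close>

text \<open>
  The machine model is first-order Lisp over binary trees with a single atom (the language F of
  N. D. Jones, \<^emph>\<open>Computability and Complexity from a Programming Perspective\<close>, with functions of
  several arguments). A program is a finite list of function bodies; in a body,
  \<open>Arg i\<close> is the \<open>i\<close>-th argument and \<open>Call f es\<close> is a call-by-value call of the \<open>f\<close>-th function.
  Every operation takes one step. The only test is whether a value is the atom, so trees can be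
  represented with sharing, each step needs constantly many pointer operations, and running
  times agree with those of Turing machines up to a polynomial.
\<close>

datatype sexp = Null | Pair sexp sexp

primrec sfst :: "sexp \<Rightarrow> sexp" where
  "sfst Null = Null"
| "sfst (Pair x y) = x"

primrec ssnd :: "sexp \<Rightarrow> sexp" where
  "ssnd Null = Null"
| "ssnd (Pair x y) = y"

datatype expr =
    Arg nat
  | NullE
  | PairE expr expr
  | FstE expr
  | SndE expr
  | IfE expr expr expr
  | Call nat "expr list"

type_synonym program = "expr list"

text \<open>\<open>eval P env e v t\<close>: in program \<open>P\<close> with arguments \<open>env\<close>, the expression \<open>e\<close> evaluates to
  \<open>v\<close> in exactly \<open>t\<close> steps; \<open>evals\<close> does the same for a list of expressions.\<close>

inductive eval :: "program \<Rightarrow> sexp list \<Rightarrow> expr \<Rightarrow> sexp \<Rightarrow> nat \<Rightarrow> bool"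
  and evals :: "program \<Rightarrow> sexp list \<Rightarrow> expr list \<Rightarrow> sexp list \<Rightarrow> nat \<Rightarrow> bool"
  for P :: program
where
  eval_Arg: "i < length env \<Longrightarrow> eval P env (Arg i) (env ! i) 1"
| eval_Null: "eval P env NullE Null 1"
| eval_Pair: "eval P env a x s \<Longrightarrow> eval P env b y t \<Longrightarrow>
    eval P env (PairE a b) (Pair x y) (s + t + 1)"
| eval_Fst: "eval P env a x s \<Longrightarrow> eval P env (FstE a) (sfst x) (s + 1)"
| eval_Snd: "eval P env a x s \<Longrightarrow> eval P env (SndE a) (ssnd x) (s + 1)"
| eval_If_True: "eval P env a x s \<Longrightarrow> x \<noteq> Null \<Longrightarrow> eval P env b y t \<Longrightarrow>
    eval P env (IfE a b c) y (s + t + 1)"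
| eval_If_False: "eval P env a Null s \<Longrightarrow> eval P env c y t \<Longrightarrow>
    eval P env (IfE a b c) y (s + t + 1)"
| eval_Call: "f < length P \<Longrightarrow> evals P env es xs s \<Longrightarrow> eval P xs (P ! f) y t \<Longrightarrow>
    eval P env (Call f es) y (s + t + 1)"
| evals_Nil: "evals P env [] [] 0"
| evals_Cons: "eval P env e x s \<Longrightarrow> evals P env es xs t \<Longrightarrow>
    evals P env (e # es) (x # xs) (s + t)"

inductive_cases eval_ArgE: "eval P env (Arg i) v t"
inductive_cases eval_NullE: "eval P env NullE v t"
inductive_cases eval_PairE: "eval P env (PairE a b) v t"
inductive_cases eval_FstE: "eval P env (FstE a) v t"
inductive_cases eval_SndE: "eval P env (SndE a) v t"
inductive_cases eval_IfE: "eval P env (IfE a b c) v t"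
inductive_cases eval_CallE: "eval P env (Call f es) v t"
inductive_cases evals_NilE: "evals P env [] vs t"
inductive_cases evals_ConsE: "evals P env (e # es) vs t"

lemma eval_deterministic:
  "eval P env e v t \<Longrightarrow> eval P env e v' t' \<Longrightarrow> v' = v \<and> t' = t"
  "evals P env es vs t \<Longrightarrow> evals P env es vs' t' \<Longrightarrow> vs' = vs \<and> t' = t"
proof (induction arbitrary: v' t' and vs' t' rule: eval_evals.inducts)
  case eval_Arg then show ?case by (auto elim: eval_ArgE)
next
  case eval_Null then show ?case by (auto elim: eval_NullE)
next
  case eval_Pair
  show ?case
    by (rule eval_PairE[OF eval_Pair.prems]) (auto dest!: eval_Pair.IH(2) eval_Pair.IH(4))
next
  case eval_Fst
  show ?case
    by (rule eval_FstE[OF eval_Fst.prems]) (auto dest!: eval_Fst.IH(2))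
next
  case eval_Snd
  show ?case
    by (rule eval_SndE[OF eval_Snd.prems]) (auto dest!: eval_Snd.IH(2))
next
  case eval_If_True
  show ?case
    by (rule eval_IfE[OF eval_If_True.prems])
      (auto dest!: eval_If_True.IH(2) eval_If_True.IH(4) simp: eval_If_True.hyps)
next
  case eval_If_False
  show ?case
    by (rule eval_IfE[OF eval_If_False.prems]) (auto dest!: eval_If_False.IH(2) eval_If_False.IH(4))
next
  case eval_Call
  show ?case
    by (rule eval_CallE[OF eval_Call.prems]) (auto dest!: eval_Call.IH(3) eval_Call.IH(5))
next
  case evals_Nil then show ?case by (auto elim: evals_NilE)
next
  case evals_Cons
  show ?case
    by (rule evals_ConsE[OF evals_Cons.prems]) (auto dest!: evals_Cons.IH(2) evals_Cons.IH(4))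
qed

definition runs :: "program \<Rightarrow> sexp \<Rightarrow> sexp \<Rightarrow> nat \<Rightarrow> bool" where
  "runs P x v t \<longleftrightarrow> eval P [x] (Call 0 [Arg 0]) v t"


section \<open>Encoding of instances\<close>

definition enc_bool :: "bool \<Rightarrow> sexp" where
  "enc_bool b = (if b then Pair Null Null else Null)"

primrec enc_list :: "('a \<Rightarrow> sexp) \<Rightarrow> 'a list \<Rightarrow> sexp" where
  "enc_list f [] = Null"
| "enc_list f (x # xs) = Pair (f x) (enc_list f xs)"

definition enc_pair :: "('a \<Rightarrow> sexp) \<Rightarrow> ('b \<Rightarrow> sexp) \<Rightarrow> 'a \<times> 'b \<Rightarrow> sexp" where
  "enc_pair f g p = Pair (f (fst p)) (g (snd p))"

text \<open>Binary digits, least significant first; zero has no digits.\<close>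

fun binary :: "nat \<Rightarrow> bool list" where
  "binary n = (if n = 0 then [] else odd n # binary (n div 2))"

declare binary.simps [simp del]

definition enc_nat :: "nat \<Rightarrow> sexp" where
  "enc_nat n = enc_list enc_bool (binary n)"

text \<open>An instance is presented by listing, without repetition and in an arbitrary order, the left
  vertices with their colors, the right vertices, the edges (left endpoint first) and the colors,
  followed by the fairness bound. Vertices and colors are named by arbitrary natural numbers, and
  all numbers are written in binary.\<close>

definition encodes :: "sexp \<Rightarrow> (nat, nat) fair_instance \<Rightarrow> bool" where
  "encodes x I \<longleftrightarrow>
     (\<exists>us vs es cs.
        distinct us \<and> set us = lefts I \<and>
        distinct vs \<and> set vs = rights I \<and>
        distinct es \<and> set es = {(u, v). u \<in> lefts I \<and> v \<in> rights I \<and> {u, v} \<in> edges I} \<and>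
        distinct cs \<and> set cs = colors I \<and>
        x = Pair (enc_list (enc_pair enc_nat enc_nat) (map (\<lambda>u. (u, coloring I u)) us))
             (Pair (enc_list enc_nat vs)
               (Pair (enc_list (enc_pair enc_nat enc_nat) es)
                 (Pair (enc_list enc_nat cs)
                   (enc_nat (bound I))))))"


section \<open>Parameterized running time\<close>

text \<open>Some program decides \<open>Q\<close> on all valid instances (the answer is yes iff the result is not
  the atom) in time \<open>O\<^sup>\<star>(f(k))\<close>, where \<open>k\<close> is the parameter of the instance: at most \<open>f(k)\<close> times a
  polynomial in the input size. The size of an input tree is its number of \<open>Pair\<close> nodes.\<close>

definition solvable_in_O_star ::
    "('i \<Rightarrow> bool) \<Rightarrow> (sexp \<Rightarrow> 'i \<Rightarrow> bool) \<Rightarrow> ('i \<Rightarrow> bool) \<Rightarrow> ('i \<Rightarrow> nat) \<Rightarrow> (nat \<Rightarrow> real) \<Rightarrow> bool" where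
  "solvable_in_O_star valid enc Q param f \<longleftrightarrow>
     (\<exists>(P :: program) (p :: real poly). \<forall>I x. valid I \<and> enc x I \<longrightarrow>
        (\<exists>v t. runs P x v t \<and> (v \<noteq> Null \<longleftrightarrow> Q I) \<and>
               real t \<le> f (param I) * poly p (real (size x))))"

end

theory Submission
  imports Defs "HOL-Library.Sublist" "HOL-Library.Transitive_Closure_Table"
begin

text \<open>
  Let \<open>m(v)\<close> be the minimum over all colors of the load of the right vertex \<open>v\<close>. Once \<open>m\<close> is fixed,
  the colors are independent of each other, and by a Hall-type theorem a color \<open>c\<close> can be assigned
  with all loads between \<open>m(v)\<close> and \<open>m(v) + l\<close>, and above \<open>m(v)\<close> on a chosen set \<open>T\<close>, iff for all
  sets \<open>S\<close> of right vertices \<open>m(S) + |S \<inter> T|\<close> is at most the number of left vertices of color \<open>c\<close>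
  with a neighbor in \<open>S\<close>, and \<open>m(S) + l |S|\<close> is at least the number of those with all neighbors in
  \<open>S\<close>. So we need an integer point \<open>m\<close> of a system of inequalities \<open>L(S) \<le> m(S) < F(S)\<close>.

  Colors are scanned one by one, guessing \<open>T\<close> and tightening \<open>F\<close> and \<open>L\<close>; the set \<open>T\<close> certifies
  nonemptiness at the vertices where \<open>m\<close> vanishes. Then the binary digits of \<open>m\<close> are guessed
  from the least significant one upwards: \<open>m = 2 m' + 1\<^sub>T\<close> turns the threshold \<open>F(S)\<close> into
  \<open>\<lceil>(F(S) - |S \<inter> T|) / 2\<rceil>\<close>, and likewise for \<open>L(S)\<close>. All guesses together only ever change a
  threshold by at most \<open>k\<close>, compared with always guessing the empty set, so at any time there are at most
  \<open>2^k (k + 1)^(2 * 2^k)\<close> different systems, and the set of all of them can be kept as a list.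
\<close>

section \<open>The decision program\<close>

text \<open>Unary numerals are lists of atoms: a successor is one \<open>PairE\<close>, addition is
  concatenation, and truncated subtraction drops tails. The thresholds stored in a state are at most
  linear in the input size, so unary notation is affordable.\<close>

primrec un :: "nat \<Rightarrow> sexp" where
  "un 0 = Null"
| "un (Suc n) = Pair Null (un n)"

abbreviation (input) TrueE :: expr where "TrueE \<equiv> PairE NullE NullE"
abbreviation (input) SucE :: "expr \<Rightarrow> expr" where "SucE e \<equiv> PairE NullE e"

abbreviation (input) EQ :: nat where "EQ \<equiv> 1"
abbreviation (input) MEM :: nat where "MEM \<equiv> 2"
abbreviation (input) APPEND :: nat where "APPEND \<equiv> 3"
abbreviation (input) MAP_CONS :: nat where "MAP_CONS \<equiv> 4"
abbreviation (input) SUBSEQS_CONS :: nat where "SUBSEQS_CONS \<equiv> 5"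
abbreviation (input) SUBSEQS :: nat where "SUBSEQS \<equiv> 6"
abbreviation (input) DIFF :: nat where "DIFF \<equiv> 7"
abbreviation (input) LEN :: nat where "LEN \<equiv> 8"
abbreviation (input) INTER :: nat where "INTER \<equiv> 9"
abbreviation (input) SUB :: nat where "SUB \<equiv> 10"
abbreviation (input) HALF :: nat where "HALF \<equiv> 11"
abbreviation (input) DOUBLE :: nat where "DOUBLE \<equiv> 12"
abbreviation (input) MINIMUM :: nat where "MINIMUM \<equiv> 13"
abbreviation (input) MAXIMUM :: nat where "MAXIMUM \<equiv> 14"
abbreviation (input) CAP :: nat where "CAP \<equiv> 15"
abbreviation (input) TOUCH :: nat where "TOUCH \<equiv> 16"
abbreviation (input) COUNT :: nat where "COUNT \<equiv> 17"
abbreviation (input) COUNT_NOT :: nat where "COUNT_NOT \<equiv> 18"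
abbreviation (input) SUB_TIMES :: nat where "SUB_TIMES \<equiv> 19"
abbreviation (input) STEP_ENTRY :: nat where "STEP_ENTRY \<equiv> 20"
abbreviation (input) STEP_VEC :: nat where "STEP_VEC \<equiv> 21"
abbreviation (input) STEP :: nat where "STEP \<equiv> 22"
abbreviation (input) INSERT :: nat where "INSERT \<equiv> 23"
abbreviation (input) CHOICES :: nat where "CHOICES \<equiv> 24"
abbreviation (input) EXPAND :: nat where "EXPAND \<equiv> 25"
abbreviation (input) EXPANDS :: nat where "EXPANDS \<equiv> 26"
abbreviation (input) ITERATE :: nat where "ITERATE \<equiv> 27"
abbreviation (input) OPS :: nat where "OPS \<equiv> 28"
abbreviation (input) INIT_VEC :: nat where "INIT_VEC \<equiv> 29"
abbreviation (input) INITS :: nat where "INITS \<equiv> 30"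
abbreviation (input) CHECK_VEC :: nat where "CHECK_VEC \<equiv> 31"
abbreviation (input) CHECK :: nat where "CHECK \<equiv> 32"

abbreviation (input) leftsE :: "expr \<Rightarrow> expr" where "leftsE x \<equiv> FstE x"
abbreviation (input) rightsE :: "expr \<Rightarrow> expr" where "rightsE x \<equiv> FstE (SndE x)"
abbreviation (input) edgesE :: "expr \<Rightarrow> expr" where "edgesE x \<equiv> FstE (SndE (SndE x))"
abbreviation (input) colorsE :: "expr \<Rightarrow> expr" where "colorsE x \<equiv> FstE (SndE (SndE (SndE x)))"
abbreviation (input) boundE :: "expr \<Rightarrow> expr" where "boundE x \<equiv> SndE (SndE (SndE (SndE x)))"

definition main_body :: expr where
  "main_body = Call CHECK [Call ITERATE
     [Call OPS [colorsE (Arg 0), Call LEN [leftsE (Arg 0)]],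
      Call INITS [Call SUBSEQS [rightsE (Arg 0)], Arg 0], Arg 0]]"

definition eq_body :: expr where
  "eq_body = IfE (Arg 0)
     (IfE (Arg 1)
        (IfE (Call EQ [FstE (Arg 0), FstE (Arg 1)]) (Call EQ [SndE (Arg 0), SndE (Arg 1)]) NullE)
        NullE)
     (IfE (Arg 1) NullE TrueE)"

definition mem_body :: expr where
  "mem_body = IfE (Arg 1)
     (IfE (Call EQ [Arg 0, FstE (Arg 1)]) TrueE (Call MEM [Arg 0, SndE (Arg 1)])) NullE"

definition append_body :: expr where
  "append_body = IfE (Arg 0)
     (PairE (FstE (Arg 0)) (Call APPEND [SndE (Arg 0), Arg 1])) (Arg 1)"

definition map_cons_body :: expr where
  "map_cons_body = IfE (Arg 1)
     (PairE (PairE (Arg 0) (FstE (Arg 1))) (Call MAP_CONS [Arg 0, SndE (Arg 1)])) NullE"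

definition subseqs_cons_body :: expr where
  "subseqs_cons_body = Call APPEND [Call MAP_CONS [Arg 0, Arg 1], Arg 1]"

definition subseqs_body :: expr where
  "subseqs_body = IfE (Arg 0)
     (Call SUBSEQS_CONS [FstE (Arg 0), Call SUBSEQS [SndE (Arg 0)]]) TrueE"

definition diff_body :: expr where
  "diff_body = IfE (Arg 0)
     (IfE (Call MEM [FstE (Arg 0), Arg 1])
        (Call DIFF [SndE (Arg 0), Arg 1])
        (PairE (FstE (Arg 0)) (Call DIFF [SndE (Arg 0), Arg 1])))
     NullE"

definition len_body :: expr where
  "len_body = IfE (Arg 0) (SucE (Call LEN [SndE (Arg 0)])) NullE"

text \<open>An intersection is the double difference xs - (xs - ys).\<close>

definition inter_body :: expr where
  "inter_body = Call LEN [Call DIFF [Arg 0, Call DIFF [Arg 0, Arg 1]]]"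

text \<open>Truncated subtraction: the tail of the atom is the atom.\<close>

definition sub_body :: expr where
  "sub_body = IfE (Arg 1) (Call SUB [SndE (Arg 0), SndE (Arg 1)]) (Arg 0)"

definition half_body :: expr where
  "half_body = IfE (Arg 0)
     (IfE (SndE (Arg 0)) (SucE (Call HALF [SndE (SndE (Arg 0))])) NullE) NullE"

definition double_body :: expr where
  "double_body = IfE (Arg 0) (SucE (SucE (Call DOUBLE [SndE (Arg 0)]))) NullE"

text \<open>min(m, n) = m - (m - n) with truncated subtraction.\<close>

definition min_body :: expr where
  "min_body = Call SUB [Arg 0, Call SUB [Arg 0, Arg 1]]"

text \<open>max(m, n) = m + (n - m) with truncated subtraction.\<close>

definition max_body :: expr where
  "max_body = Call APPEND [Arg 0, Call SUB [Arg 1, Arg 0]]"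

text \<open>Horner evaluation of a binary numeral, truncated at every digit: intermediate unary
  values stay at most 2n + 1 for the cap n, although the numeral may denote an exponentially large
  number.\<close>

definition cap_body :: expr where
  "cap_body = IfE (Arg 0)
     (Call MINIMUM [Arg 1,
        Call APPEND [FstE (Arg 0), Call DOUBLE [Call CAP [SndE (Arg 0), Arg 1]]]]) NullE"

definition touch_body :: expr where
  "touch_body = IfE (Arg 2)
     (IfE (Call EQ [Arg 0, FstE (FstE (Arg 2))])
        (IfE (Call MEM [SndE (FstE (Arg 2)), Arg 1]) TrueE
           (Call TOUCH [Arg 0, Arg 1, SndE (Arg 2)]))
        (Call TOUCH [Arg 0, Arg 1, SndE (Arg 2)]))
     NullE"

definition count_body :: expr where
  "count_body = IfE (Arg 0)
     (IfE (Call EQ [Arg 1, SndE (FstE (Arg 0))])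
        (IfE (Call TOUCH [FstE (FstE (Arg 0)), Arg 2, Arg 3])
           (SucE (Call COUNT [SndE (Arg 0), Arg 1, Arg 2, Arg 3]))
           (Call COUNT [SndE (Arg 0), Arg 1, Arg 2, Arg 3]))
        (Call COUNT [SndE (Arg 0), Arg 1, Arg 2, Arg 3]))
     NullE"

definition count_not_body :: expr where
  "count_not_body = IfE (Arg 0)
     (IfE (Call EQ [Arg 1, SndE (FstE (Arg 0))])
        (IfE (Call TOUCH [FstE (FstE (Arg 0)), Arg 2, Arg 3])
           (Call COUNT_NOT [SndE (Arg 0), Arg 1, Arg 2, Arg 3])
           (SucE (Call COUNT_NOT [SndE (Arg 0), Arg 1, Arg 2, Arg 3])))
        (Call COUNT_NOT [SndE (Arg 0), Arg 1, Arg 2, Arg 3]))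
     NullE"

definition sub_times_body :: expr where
  "sub_times_body = IfE (Arg 1)
     (Call SUB_TIMES [Call SUB [Arg 0, Arg 2], SndE (Arg 1), Arg 2]) (Arg 0)"

text \<open>The left vertices with all neighbors in \<open>S\<close> are counted as those avoiding
  the complement of \<open>S\<close>. The upper threshold \<open>F\<close> is strict, hence the
  successor around the count: an unsatisfiable constraint then appears as F = 0, and truncated
  subtraction loses no information.\<close>

definition step_entry_body :: expr where
  "step_entry_body = (let S = FstE (Arg 0); F = FstE (SndE (Arg 0)); L = SndE (SndE (Arg 0));
      x = Arg 3; ST = Call INTER [S, Arg 2] in
    PairE S (IfE (Arg 1)
      (PairE
        (Call MINIMUM [F, Call SUB [SucE (Call COUNT [leftsE x, FstE (Arg 1), S, edgesE x]), ST]])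
        (Call MAXIMUM [L, Call SUB_TIMES
          [Call COUNT_NOT [leftsE x, FstE (Arg 1), Call DIFF [rightsE x, S], edgesE x],
           S, Call CAP [boundE x, Call LEN [leftsE x]]]]))
      (PairE (Call HALF [Call SUB [SucE F, ST]]) (Call HALF [Call SUB [SucE L, ST]]))))"

definition step_vec_body :: expr where
  "step_vec_body = IfE (Arg 0)
     (PairE (Call STEP_ENTRY [FstE (Arg 0), Arg 1, Arg 2, Arg 3])
        (Call STEP_VEC [SndE (Arg 0), Arg 1, Arg 2, Arg 3]))
     NullE"

definition step_body :: expr where
  "step_body = PairE (IfE (Arg 1) (Call DIFF [FstE (Arg 0), Arg 2]) (FstE (Arg 0)))
     (Call STEP_VEC [SndE (Arg 0), Arg 1, Arg 2, Arg 3])"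

text \<open>Removing duplicates bounds a list of states by the number of distinct states; otherwise
  it would grow with the number of guess sequences.\<close>

definition insert_body :: expr where
  "insert_body = IfE (Call MEM [Arg 0, Arg 1]) (Arg 1) (PairE (Arg 0) (Arg 1))"

text \<open>The code of l is the atom iff l = 0, so it can serve as a test; \<open>TrueE\<close> is
  the code of the list containing only the empty list.\<close>

definition choices_body :: expr where
  "choices_body = IfE (Arg 0)
     (IfE (boundE (Arg 1)) (Call SUBSEQS [rightsE (Arg 1)]) TrueE)
     (Call SUBSEQS [rightsE (Arg 1)])"

definition expand_body :: expr where
  "expand_body = IfE (Arg 0)
     (Call EXPAND [SndE (Arg 0), Arg 1,
        Call INSERT [Call STEP [Arg 1, Arg 3, FstE (Arg 0), Arg 4], Arg 2], Arg 3, Arg 4])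
     (Arg 2)"

definition expands_body :: expr where
  "expands_body = IfE (Arg 0)
     (Call EXPANDS [SndE (Arg 0),
        Call EXPAND [Call CHOICES [Arg 2, Arg 3], FstE (Arg 0), Arg 1, Arg 2, Arg 3], Arg 2, Arg 3])
     (Arg 1)"

definition iterate_body :: expr where
  "iterate_body = IfE (Arg 0)
     (Call ITERATE [SndE (Arg 0), Call EXPANDS [Arg 1, NullE, FstE (Arg 0), Arg 2], Arg 2])
     (Arg 1)"

text \<open>A halving operation is encoded by the atom, so a unary numeral m already is the encoded
  list of m halvings and can end the list of operations unchanged.\<close>

definition ops_body :: expr where
  "ops_body = IfE (Arg 0)
     (PairE (PairE (FstE (Arg 0)) NullE) (Call OPS [SndE (Arg 0), Arg 1])) (Arg 1)"

definition init_vec_body :: expr where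
  "init_vec_body = IfE (Arg 0)
     (PairE
        (PairE (FstE (Arg 0))
           (PairE (SucE (Call LEN [leftsE (Arg 2)])) (Call LEN [Call DIFF [FstE (Arg 0), Arg 1]])))
        (Call INIT_VEC [SndE (Arg 0), Arg 1, Arg 2]))
     NullE"

definition inits_body :: expr where
  "inits_body = IfE (Arg 0)
     (PairE
        (PairE (FstE (Arg 0))
           (Call INIT_VEC [Call SUBSEQS [rightsE (Arg 1)], FstE (Arg 0), Arg 1]))
        (Call INITS [SndE (Arg 0), Arg 1]))
     NullE"

definition check_vec_body :: expr where
  "check_vec_body = IfE (Arg 0)
     (IfE (FstE (SndE (FstE (Arg 0))))
        (IfE (SndE (SndE (FstE (Arg 0)))) NullE (Call CHECK_VEC [SndE (Arg 0)])) NullE)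
     TrueE"

definition check_body :: expr where
  "check_body = IfE (Arg 0)
     (IfE (FstE (FstE (Arg 0)))
        (Call CHECK [SndE (Arg 0)])
        (IfE (Call CHECK_VEC [SndE (FstE (Arg 0))]) TrueE (Call CHECK [SndE (Arg 0)])))
     NullE"

definition prog :: program where
  "prog = [main_body, eq_body, mem_body, append_body, map_cons_body, subseqs_cons_body,
     subseqs_body, diff_body, len_body, inter_body, sub_body, half_body, double_body, min_body,
     max_body, cap_body, touch_body, count_body, count_not_body, sub_times_body, step_entry_body,
     step_vec_body, step_body, insert_body, choices_body, expand_body, expands_body, iterate_body,
     ops_body, init_vec_body, inits_body, check_vec_body, check_body]"

lemma length_prog: "length prog = 33"
  by (simp add: prog_def)

lemma prog_nth:
  "prog ! 0 = main_body" "prog ! EQ = eq_body" "prog ! MEM = mem_body"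
  "prog ! APPEND = append_body" "prog ! MAP_CONS = map_cons_body"
  "prog ! SUBSEQS_CONS = subseqs_cons_body" "prog ! SUBSEQS = subseqs_body"
  "prog ! DIFF = diff_body" "prog ! LEN = len_body" "prog ! INTER = inter_body"
  "prog ! SUB = sub_body" "prog ! HALF = half_body" "prog ! DOUBLE = double_body"
  "prog ! MINIMUM = min_body" "prog ! MAXIMUM = max_body" "prog ! CAP = cap_body"
  "prog ! TOUCH = touch_body" "prog ! COUNT = count_body" "prog ! COUNT_NOT = count_not_body"
  "prog ! SUB_TIMES = sub_times_body" "prog ! STEP_ENTRY = step_entry_body"
  "prog ! STEP_VEC = step_vec_body" "prog ! STEP = step_body" "prog ! INSERT = insert_body"
  "prog ! CHOICES = choices_body" "prog ! EXPAND = expand_body" "prog ! EXPANDS = expands_body"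
  "prog ! ITERATE = iterate_body" "prog ! OPS = ops_body" "prog ! INIT_VEC = init_vec_body"
  "prog ! INITS = inits_body" "prog ! CHECK_VEC = check_vec_body" "prog ! CHECK = check_body"
  by (simp_all add: prog_def)


section \<open>Evaluation with time bounds\<close>

text \<open>Exact step counts are relaxed to upper bounds, so that costs can be rounded up and the
  costs of alternative branches merged.\<close>

definition evb :: "sexp list \<Rightarrow> expr \<Rightarrow> sexp \<Rightarrow> nat \<Rightarrow> bool" where
  "evb env e v t \<longleftrightarrow> (\<exists>t'\<le>t. eval prog env e v t')"

definition fn :: "nat \<Rightarrow> sexp list \<Rightarrow> sexp \<Rightarrow> nat \<Rightarrow> bool" where
  "fn f xs v t \<longleftrightarrow> f < length prog \<and> evb xs (prog ! f) v t"

text \<open>Keeping the value of the test as an argument lets resolution pick the branch rule after the test has been evaluated.\<close>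

definition branch :: "sexp \<Rightarrow> sexp list \<Rightarrow> expr \<Rightarrow> expr \<Rightarrow> sexp \<Rightarrow> nat \<Rightarrow> bool" where
  "branch x env b c v t \<longleftrightarrow> (if x = Null then evb env c v t else evb env b v t)"

lemma evb_weaken: "evb env e v s \<Longrightarrow> v = w \<Longrightarrow> s \<le> t \<Longrightarrow> evb env e w t"
  unfolding evb_def by (meson le_trans)

lemma fn_weaken: "fn f xs v s \<Longrightarrow> v = w \<Longrightarrow> s \<le> t \<Longrightarrow> fn f xs w t"
  unfolding fn_def by (blast intro: evb_weaken)

lemma evb_nth: "i < length env \<Longrightarrow> env ! i = x \<Longrightarrow> evb env (Arg i) x 1"
  unfolding evb_def using eval_Arg by blast

lemma evb_Arg:
  "evb (a # env) (Arg 0) a 1"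
  "evb (a # b # env) (Arg 1) b 1"
  "evb (a # b # c # env) (Arg 2) c 1"
  "evb (a # b # c # d # env) (Arg 3) d 1"
  "evb (a # b # c # d # e # env) (Arg 4) e 1"
  by (rule evb_nth; simp)+

lemma evb_Null: "evb env NullE Null 1"
  unfolding evb_def using eval_Null by blast

lemma evb_Pair: "evb env a x s \<Longrightarrow> evb env b y t \<Longrightarrow> evb env (PairE a b) (Pair x y) (s + t + 1)"
  unfolding evb_def by (meson add_le_mono eval_Pair le_refl)

lemma evb_Fst: "evb env a (Pair x y) s \<Longrightarrow> evb env (FstE a) x (s + 1)"
  unfolding evb_def by (metis add_le_mono1 eval_Fst sfst.simps(2))

lemma evb_Snd: "evb env a (Pair x y) s \<Longrightarrow> evb env (SndE a) y (s + 1)"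
  unfolding evb_def by (metis add_le_mono1 eval_Snd ssnd.simps(2))

lemma evb_Snd_un: "evb env a (un n) s \<Longrightarrow> evb env (SndE a) (un (n - 1)) (s + 1)"
proof -
  have "ssnd (un n) = un (n - 1)"
    by (cases n) auto
  then show "evb env a (un n) s \<Longrightarrow> evb env (SndE a) (un (n - 1)) (s + 1)"
    unfolding evb_def by (metis add_le_mono1 eval_Snd)
qed

lemma evb_If:
  assumes "evb env a x s" "branch x env b c v t"
  shows "evb env (IfE a b c) v (s + t + 1)"
proof -
  obtain s' where s': "s' \<le> s" "eval prog env a x s'"
    using assms(1) by (auto simp: evb_def)
  obtain t' where t': "t' \<le> t" "eval prog env (if x = Null then c else b) v t'"
    using assms(2) by (auto simp: branch_def evb_def split: if_splits)
  have "eval prog env (IfE a b c) v (s' + t' + 1)"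
  proof (cases "x = Null")
    case True
    with s' t' show ?thesis by (auto intro: eval_If_False simp del: One_nat_def add_Suc_right)
  next
    case False
    with s' t' show ?thesis by (simp only: if_False) (rule eval_If_True)
  qed
  then show ?thesis
    unfolding evb_def using s'(1) t'(1) by (intro exI[of _ "s' + t' + 1"]) simp
qed

lemma branch_Null: "evb env c v t \<Longrightarrow> branch Null env b c v t"
  by (simp add: branch_def)

lemma branch_Pair: "evb env b v t \<Longrightarrow> branch (Pair x y) env b c v t"
  by (simp add: branch_def)

text \<open>For tests whose outcome stays symbolic: each branch is derived under its own outcome,
  and the larger cost is charged.\<close>

lemma branch_bool:
  assumes "p \<Longrightarrow> evb env b v s" "\<not> p \<Longrightarrow> evb env c w t"
  shows "branch (enc_bool p) env b c (if p then v else w) (max s t)"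
  using assms by (auto simp: branch_def enc_bool_def intro: evb_weaken)

definition evbs :: "sexp list \<Rightarrow> expr list \<Rightarrow> sexp list \<Rightarrow> nat \<Rightarrow> bool" where
  "evbs env es xs t \<longleftrightarrow> (\<exists>t'\<le>t. evals prog env es xs t')"

lemma evbs_Nil: "evbs env [] [] 0"
  unfolding evbs_def using evals_Nil by blast

lemma evbs_Cons: "evb env e x s \<Longrightarrow> evbs env es xs t \<Longrightarrow> evbs env (e # es) (x # xs) (s + t)"
  unfolding evb_def evbs_def by (meson add_le_mono evals_Cons)

lemma evb_call:
  assumes "evbs env es xs s" "fn f xs v t"
  shows "evb env (Call f es) v (s + t + 1)"
proof -
  obtain s' where "s' \<le> s" "evals prog env es xs s'"
    using assms(1) by (auto simp: evbs_def)
  moreover obtain t' where "t' \<le> t" "f < length prog" "eval prog xs (prog ! f) v t'"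
    using assms(2) by (auto simp: fn_def evb_def)
  ultimately show ?thesis
    unfolding evb_def by (meson add_le_mono eval_Call le_refl)
qed

lemmas evb_rules = evb_Arg evb_Null evb_Pair evb_Fst evb_Snd evb_If
  branch_Null branch_Pair branch_bool evb_call evbs_Nil evbs_Cons

lemmas bodies = prog_nth[unfolded main_body_def eq_body_def mem_body_def append_body_def
  map_cons_body_def subseqs_cons_body_def subseqs_body_def diff_body_def len_body_def
  inter_body_def sub_body_def half_body_def double_body_def min_body_def max_body_def cap_body_def
  touch_body_def count_body_def count_not_body_def sub_times_body_def step_entry_body_def Let_def
  step_vec_body_def step_body_def insert_body_def choices_body_def expand_body_def
  expands_body_def iterate_body_def ops_body_def init_vec_body_def inits_body_def
  check_vec_body_def check_body_def]

text \<open>The pattern of all cost proofs: resolution with \<open>evb_rules\<close> synthesizes the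
  value \<open>v\<close> and the cost \<open>s\<close> from the body, and the last two premises
  compare them with the claimed ones.\<close>

lemma fn_intro:
  "prog ! f = e \<Longrightarrow> f < 33 \<Longrightarrow> evb xs e v s \<Longrightarrow> v = w \<Longrightarrow> s \<le> t \<Longrightarrow> fn f xs w t"
  by (auto simp: fn_def length_prog intro: evb_weaken)

text \<open>Both trees are descended in lockstep, so the first one alone bounds the recursion. At a
  pair node the two recursive bounds contribute 20 each, which leaves 50 + 20 - 40 = 30 steps for
  the node itself.\<close>

lemma fn_eq_size: "fn EQ [a, b] (enc_bool (a = b)) (50 * size a + 20)"
proof (induction a arbitrary: b)
  case Null
  show ?case
  proof (cases b)
    case Null
    show ?thesis unfolding Null
      by (rule fn_intro, rule bodies, simp, (rule evb_rules)+, simp_all add: enc_bool_def)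
  next
    case (Pair b1 b2)
    show ?thesis unfolding Pair
      by (rule fn_intro, rule bodies, simp, (rule evb_rules)+, simp_all add: enc_bool_def)
  qed
next
  case (Pair a1 a2)
  show ?case
  proof (cases b)
    case Null
    show ?thesis unfolding Null
      by (rule fn_intro, rule bodies, simp, (rule evb_rules)+, simp_all add: enc_bool_def)
  next
    case b: (Pair b1 b2)
    show ?thesis unfolding b
      by (rule fn_intro, rule bodies, simp, (rule evb_rules Pair)+, simp_all add: enc_bool_def)
  qed
qed


section \<open>Cost of the auxiliary functions\<close>

lemma length_le_size_enc_list: "length xs \<le> size (enc_list f xs)"
  by (induction xs) auto

lemma size_le_size_enc_list: "x \<in> set xs \<Longrightarrow> size (f x) \<le> size (enc_list f xs)"
  by (induction xs) auto

lemma size_un [simp]: "size (un n) = n"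
  by (induction n) auto

text \<open>With injective encodings, structural comparison of codes decides equality of the encoded
  objects; the membership tests of the program rely on this.\<close>

lemma inj_enc_list:
  assumes "inj f"
  shows "inj (enc_list f)"
proof (rule injI)
  fix xs ys
  show "enc_list f xs = enc_list f ys \<Longrightarrow> xs = ys"
  proof (induction xs arbitrary: ys)
    case Nil
    then show ?case by (cases ys) auto
  next
    case (Cons x xs)
    then show ?case by (cases ys) (auto dest: injD[OF assms])
  qed
qed

lemma un_eq_iff [simp]: "un m = un n \<longleftrightarrow> m = n"
proof (induction m arbitrary: n)
  case 0
  then show ?case by (cases n) auto
next
  case (Suc m)
  then show ?case by (cases n) auto
qed


primrec binary_value :: "bool list \<Rightarrow> nat" where
  "binary_value [] = 0"
| "binary_value (b # bs) = of_bool b + 2 * binary_value bs"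

lemma binary_value_binary: "binary_value (binary n) = n"
proof (induction n rule: binary.induct)
  case (1 n)
  show ?case
  proof (cases "n = 0")
    case True
    then show ?thesis by (simp add: binary.simps[of 0])
  next
    case False
    then show ?thesis using 1 by (subst binary.simps) simp
  qed
qed

lemma inj_enc_nat: "inj enc_nat"
proof -
  have "inj enc_bool"
    by (auto simp: inj_def enc_bool_def)
  then have "inj (enc_list enc_bool)"
    by (rule inj_enc_list)
  moreover have "inj binary"
    by (metis binary_value_binary injI)
  ultimately have "inj (enc_list enc_bool \<circ> binary)"
    by (rule inj_compose)
  moreover have "enc_nat = enc_list enc_bool \<circ> binary"
    by (simp add: fun_eq_iff enc_nat_def)
  ultimately show ?thesis
    by simp
qed

lemma enc_nat_eq_iff [simp]: "enc_nat m = enc_nat n \<longleftrightarrow> m = n"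
  by (simp add: inj_eq inj_enc_nat)

lemma enc_bool_eq_un: "enc_bool b = un (of_bool b)"
  by (simp add: enc_bool_def)

lemma enc_pair_Pair: "enc_pair f g (x, y) = Pair (f x) (g y)"
  by (simp add: enc_pair_def)

abbreviation (input) enc_nats :: "nat list \<Rightarrow> sexp" where
  "enc_nats \<equiv> enc_list enc_nat"

abbreviation (input) enc_nat_pairs :: "(nat \<times> nat) list \<Rightarrow> sexp" where
  "enc_nat_pairs \<equiv> enc_list (enc_pair enc_nat enc_nat)"

definition touches :: "(nat \<times> nat) list \<Rightarrow> nat list \<Rightarrow> nat \<Rightarrow> bool" where
  "touches es S u \<longleftrightarrow> (\<exists>v\<in>set S. (u, v) \<in> set es)"

definition count_touching :: "(nat \<times> nat) list \<Rightarrow> (nat \<times> nat) list \<Rightarrow> nat \<Rightarrow> nat list \<Rightarrow> nat" where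
  "count_touching ucs es c S = length (filter (\<lambda>(u, c'). c' = c \<and> touches es S u) ucs)"

definition count_avoiding :: "(nat \<times> nat) list \<Rightarrow> (nat \<times> nat) list \<Rightarrow> nat \<Rightarrow> nat list \<Rightarrow> nat" where
  "count_avoiding ucs es c S = length (filter (\<lambda>(u, c'). c' = c \<and> \<not> touches es S u) ucs)"

primrec capped :: "nat \<Rightarrow> bool list \<Rightarrow> nat" where
  "capped n [] = 0"
| "capped n (b # bs) = min n (of_bool b + 2 * capped n bs)"

text \<open>Truncating at each digit agrees with truncating once at the end: if the higher digits
  already reach n, then so does the doubled value.\<close>

lemma capped_eq: "capped n bs = min n (binary_value bs)"
  by (induction bs) auto

text \<open>The cost classes are kept opaque so that arithmetic treats each of them as an atom.\<close>

definition cost :: "nat \<Rightarrow> nat \<Rightarrow> nat" where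
  "cost N d = N ^ d"

locale cost_bound =
  fixes N :: nat
  assumes N: "100 \<le> N"
begin

abbreviation (input) q :: "nat \<Rightarrow> nat" where "q \<equiv> cost N"

text \<open>The next class absorbs a hundredfold sum of the previous one, which pays for the fixed
  number of calls and elementary steps in a body.\<close>

lemma cost_step: "100 * q d \<le> q (Suc d)"
  using N by (simp add: cost_def)

lemma hundred_le_cost: "100 \<le> q 2"
proof -
  have "100 * 1 \<le> N * N"
    using N by (intro mult_le_mono) auto
  then show ?thesis
    by (simp add: cost_def power2_eq_square)
qed

lemmas qs = hundred_le_cost cost_step[of 2, simplified] cost_step[of 3, simplified]
  cost_step[of 4, simplified] cost_step[of 5, simplified] cost_step[of 6, simplified]
  cost_step[of 7, simplified] cost_step[of 8, simplified] cost_step[of 9, simplified]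
  cost_step[of 10, simplified] cost_step[of 11, simplified] cost_step[of 12, simplified]
  cost_step[of 13, simplified] cost_step[of 14, simplified] cost_step[of 15, simplified]
  cost_step[of 16, simplified] cost_step[of 17, simplified] cost_step[of 18, simplified]
  cost_step[of 19, simplified] cost_step[of 20, simplified]

text \<open>A recursion with fewer than N rounds, each within class d, stays within class d + 1. The
  summand 1 pays for the terminating call.\<close>

lemma fn_loop:
  assumes "fn f xs v ((n + 1) * q d)" "n < N" "e = Suc d"
  shows "fn f xs v (q e)"
proof -
  have "(n + 1) * N ^ d \<le> N * N ^ d"
    using assms(2) by (intro mult_le_mono) auto
  then show ?thesis
    using assms by (auto intro: fn_weaken simp: cost_def)
qed

section \<open>Comparison and list operations\<close>

lemma fn_eq: "size a \<le> N \<Longrightarrow> fn EQ [a, b] (enc_bool (a = b)) (q 2)"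
proof (rule fn_weaken[OF fn_eq_size refl])
  assume "size a \<le> N"
  then have "50 * size a + 20 \<le> 100 * N"
    using N by simp
  also have "\<dots> \<le> q 2"
    using N by (simp add: cost_def power2_eq_square)
  finally show "50 * size a + 20 \<le> q 2" .
qed

lemma fn_mem:
  assumes "size a \<le> N" "length xs < N"
  shows "fn MEM [a, enc_list f xs] (enc_bool (a \<in> f ` set xs)) (q 4)"
proof (rule fn_loop[OF _ assms(2)])
  show "fn MEM [a, enc_list f xs] (enc_bool (a \<in> f ` set xs)) ((length xs + 1) * q 3)"
  proof (induction xs)
    case Nil
    show ?case unfolding enc_list.simps
      by (rule fn_intro, rule bodies, simp, (rule evb_rules)+,
          use qs(1,2) in \<open>auto simp: enc_bool_def\<close>)
  next
    case (Cons x xs)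
    show ?case unfolding enc_list.simps
      by (rule fn_intro, rule bodies, simp, (rule evb_rules fn_eq Cons assms)+,
          use qs(1,2) in \<open>auto simp: enc_bool_def\<close>)
  qed
qed simp

lemma fn_append:
  assumes "length xs < N"
  shows "fn APPEND [enc_list f xs, enc_list f ys] (enc_list f (xs @ ys)) (q 3)"
proof (rule fn_loop[OF _ assms])
  show "fn APPEND [enc_list f xs, enc_list f ys] (enc_list f (xs @ ys)) ((length xs + 1) * q 2)"
  proof (induction xs)
    case Nil
    show ?case unfolding enc_list.simps
      by (rule fn_intro, rule bodies, simp, (rule evb_rules)+, use qs(1) in auto)
  next
    case (Cons x xs)
    show ?case unfolding enc_list.simps
      by (rule fn_intro, rule bodies, simp, (rule evb_rules Cons)+, use qs(1) in auto)
  qed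
qed simp

lemma fn_map_cons:
  assumes "length xss < N"
  shows "fn MAP_CONS [f v, enc_list (enc_list f) xss]
    (enc_list (enc_list f) (map ((#) v) xss)) (q 3)"
proof (rule fn_loop[OF _ assms])
  show "fn MAP_CONS [f v, enc_list (enc_list f) xss]
    (enc_list (enc_list f) (map ((#) v) xss)) ((length xss + 1) * q 2)"
  proof (induction xss)
    case Nil
    show ?case unfolding enc_list.simps
      by (rule fn_intro, rule bodies, simp, (rule evb_rules)+, use qs(1) in auto)
  next
    case (Cons x xss)
    show ?case unfolding enc_list.simps
      by (rule fn_intro, rule bodies, simp, (rule evb_rules Cons)+, use qs(1) in auto)
  qed
qed simp

lemma fn_subseqs_cons:
  assumes "length xss < N"
  shows "fn SUBSEQS_CONS [f v, enc_list (enc_list f) xss]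
    (enc_list (enc_list f) (map ((#) v) xss @ xss)) (q 4)"
  by (rule fn_intro, rule bodies, simp,
      (rule evb_rules fn_append fn_map_cons assms | (simp add: assms; fail))+,
      use qs(1-3) in auto)

text \<open>Every level copies the list of subsequences of the tail, so the recursion is short but
  needs 2 to the length of the list below N.\<close>

lemma fn_subseqs:
  assumes "2 ^ length xs < N"
  shows "fn SUBSEQS [enc_list f xs] (enc_list (enc_list f) (subseqs xs)) (q 6)"
proof (rule fn_loop)
  show "fn SUBSEQS [enc_list f xs] (enc_list (enc_list f) (subseqs xs)) ((length xs + 1) * q 5)"
    using assms
  proof (induction xs)
    case Nil
    show ?case unfolding enc_list.simps
      by (rule fn_intro, rule bodies, simp, (rule evb_rules)+, use qs(1-4) in auto)
  next
    case (Cons x xs)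
    then have IH: "fn SUBSEQS [enc_list f xs] (enc_list (enc_list f) (subseqs xs))
        ((length xs + 1) * q 5)" and len: "length (subseqs xs) < N"
      by (auto simp: length_subseqs)
    show ?case unfolding enc_list.simps
      by (rule fn_intro, rule bodies, simp, (rule evb_rules fn_subseqs_cons IH len)+,
          use qs(1-4) in \<open>auto simp: Let_def\<close>)
  qed
  show "length xs < N"
    using assms less_exp[of "length xs"] by linarith
qed simp

lemma fn_diff:
  assumes "inj f" "size (enc_list f xs) < N" "length ys < N"
  shows "fn DIFF [enc_list f xs, enc_list f ys]
    (enc_list f (filter (\<lambda>x. x \<notin> set ys) xs)) (q 6)"
proof (rule fn_loop)
  show "fn DIFF [enc_list f xs, enc_list f ys]
    (enc_list f (filter (\<lambda>x. x \<notin> set ys) xs)) ((length xs + 1) * q 5)"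
    using assms(2)
  proof (induction xs)
    case Nil
    show ?case unfolding enc_list.simps
      by (rule fn_intro, rule bodies, simp, (rule evb_rules)+, use qs(1-4) in auto)
  next
    case (Cons x xs)
    then have IH: "fn DIFF [enc_list f xs, enc_list f ys]
        (enc_list f (filter (\<lambda>x. x \<notin> set ys) xs)) ((length xs + 1) * q 5)"
      and size: "size (f x) \<le> N"
      by auto
    show ?case unfolding enc_list.simps
      by (rule fn_intro, rule bodies, simp, (rule evb_rules fn_mem IH size assms(3))+,
          use qs(1-4) in \<open>auto simp: inj_image_mem_iff[OF assms(1)]\<close>)
  qed
  show "length xs < N"
    using assms(2) length_le_size_enc_list[of xs f] by linarith
qed simp

lemma fn_len:
  assumes "length xs < N"
  shows "fn LEN [enc_list f xs] (un (length xs)) (q 3)"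
proof (rule fn_loop[OF _ assms])
  show "fn LEN [enc_list f xs] (un (length xs)) ((length xs + 1) * q 2)"
  proof (induction xs)
    case Nil
    show ?case unfolding enc_list.simps
      by (rule fn_intro, rule bodies, simp, (rule evb_rules)+, use qs(1) in auto)
  next
    case (Cons x xs)
    show ?case unfolding enc_list.simps
      by (rule fn_intro, rule bodies, simp, (rule evb_rules Cons)+, use qs(1) in auto)
  qed
qed simp

lemma fn_inter:
  assumes "inj f" "size (enc_list f xs) < N" "length ys < N"
  shows "fn INTER [enc_list f xs, enc_list f ys]
    (un (length (filter (\<lambda>x. x \<in> set ys) xs))) (q 7)"
proof -
  have len: "length (filter P xs) < N" for P
    using assms(2) length_le_size_enc_list[of xs f] length_filter_le[of P xs] by linarith
  have eq: "filter (\<lambda>x. x \<notin> set (filter (\<lambda>x. x \<notin> set ys) xs)) xs = filter (\<lambda>x. x \<in> set ys) xs"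
    by (rule filter_cong) auto
  show ?thesis
    by (rule fn_intro, rule bodies, simp, (rule evb_rules fn_diff fn_len assms len)+,
        use qs(1-6) eq in auto)
qed

section \<open>Arithmetic on unary numerals\<close>

lemma fn_sub:
  assumes "n < N"
  shows "fn SUB [un m, un n] (un (m - n)) (q 3)"
proof (rule fn_loop[OF _ assms])
  show "fn SUB [un m, un n] (un (m - n)) ((n + 1) * q 2)"
  proof (induction n arbitrary: m)
    case 0
    show ?case unfolding un.simps
      by (rule fn_intro, rule bodies, simp, (rule evb_rules)+, use qs(1) in auto)
  next
    case (Suc n)
    show ?case unfolding un.simps
      \<comment> \<open>The first numeral may already be exhausted. The tail of the atom is the
        atom, so \<open>evb_Snd_un\<close> applies where \<open>evb_Snd\<close> would demand a
        pair.\<close>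
      by (rule fn_intro, rule bodies, simp, rule evb_If, rule evb_rules, rule evb_rules,
          rule evb_call, rule evb_rules, rule evb_Snd_un, (rule evb_rules Suc)+, use qs(1) in auto)
  qed
qed simp

lemma fn_half:
  assumes "n < N"
  shows "fn HALF [un n] (un (n div 2)) (q 3)"
proof (rule fn_loop[OF _ assms])
  show "fn HALF [un n] (un (n div 2)) ((n + 1) * q 2)"
  proof (induction n rule: induct_nat_012)
    case 0
    show ?case unfolding un.simps
      by (rule fn_intro, rule bodies, simp, (rule evb_rules)+, use qs(1) in auto)
  next
    case 1
    show ?case unfolding un.simps
      by (rule fn_intro, rule bodies, simp, (rule evb_rules)+, use qs(1) in auto)
  next
    case (ge2 n)
    show ?case unfolding un.simps
      by (rule fn_intro, rule bodies, simp, (rule evb_rules ge2)+, use qs(1) in auto)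
  qed
qed simp

lemma fn_double:
  assumes "n < N"
  shows "fn DOUBLE [un n] (un (2 * n)) (q 3)"
proof (rule fn_loop[OF _ assms])
  show "fn DOUBLE [un n] (un (2 * n)) ((n + 1) * q 2)"
  proof (induction n)
    case 0
    show ?case unfolding un.simps
      by (rule fn_intro, rule bodies, simp, (rule evb_rules)+, use qs(1) in auto)
  next
    case (Suc n)
    show ?case unfolding un.simps
      by (rule fn_intro, rule bodies, simp, (rule evb_rules Suc)+, use qs(1) in auto)
  qed
qed simp

text \<open>A unary numeral is a list of units, so this is an instance of concatenation.\<close>

lemma fn_add:
  assumes "m < N"
  shows "fn APPEND [un m, un n] (un (m + n)) (q 3)"
proof -
  have un: "un n = enc_list (\<lambda>_. Null) (replicate n ())" for n
    by (induction n) auto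
  show ?thesis
    using fn_append[of "replicate m ()" "\<lambda>_. Null" "replicate n ()"] assms
    by (simp add: un replicate_add)
qed

lemma fn_min:
  assumes "m < N" "n < N"
  shows "fn MINIMUM [un m, un n] (un (min m n)) (q 4)"
proof -
  have "m - n < N"
    using assms by auto
  note rules = fn_sub assms this
  show ?thesis
    by (rule fn_intro, rule bodies, simp, (rule evb_rules rules)+, use qs(1-3) in auto)
qed

lemma fn_max:
  assumes "m < N" "n < N"
  shows "fn MAXIMUM [un m, un n] (un (max m n)) (q 4)"
  by (rule fn_intro, rule bodies, simp, (rule evb_rules fn_sub fn_add assms)+, use qs(1-3) in auto)

lemma fn_cap:
  assumes "length bs < N" "2 * n + 1 < N"
  shows "fn CAP [enc_list enc_bool bs, un n] (un (capped n bs)) (q 6)"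
proof (rule fn_loop[OF _ assms(1)])
  show "fn CAP [enc_list enc_bool bs, un n] (un (capped n bs)) ((length bs + 1) * q 5)"
  proof (induction bs)
    case Nil
    show ?case unfolding enc_list.simps
      by (rule fn_intro, rule bodies, simp, (rule evb_rules)+, use qs(1-4) in auto)
  next
    case (Cons b bs)
    have le: "capped n bs \<le> n"
      by (simp add: capped_eq)
    then have "n < N" "of_bool b < N" "of_bool b + 2 * capped n bs < N" "capped n bs < N"
      using assms(2) by (cases b; simp)+
    note rules = fn_min fn_add fn_double Cons this
    show ?case unfolding enc_list.simps enc_bool_eq_un[of b]
      by (rule fn_intro, rule bodies, simp, (rule evb_rules rules)+, use qs(1-4) in auto)
  qed
qed simp

section \<open>Counting left vertices by color and neighborhood\<close>

lemma fn_touch: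
  assumes "size (enc_nat u) \<le> N" "length S < N" "size (enc_nat_pairs es) < N"
  shows "fn TOUCH [enc_nat u, enc_nats S, enc_nat_pairs es] (enc_bool (touches es S u)) (q 6)"
proof (rule fn_loop)
  show "fn TOUCH [enc_nat u, enc_nats S, enc_nat_pairs es] (enc_bool (touches es S u))
    ((length es + 1) * q 5)"
    using assms(3)
  proof (induction es)
    case Nil
    show ?case unfolding enc_list.simps
      by (rule fn_intro, rule bodies, simp, (rule evb_rules)+,
          use qs(1-4) in \<open>auto simp: touches_def enc_bool_def\<close>)
  next
    case (Cons e es)
    obtain u' v where e: "e = (u', v)"
      by (cases e)
    have IH: "fn TOUCH [enc_nat u, enc_nats S, enc_nat_pairs es] (enc_bool (touches es S u))
        ((length es + 1) * q 5)" and size: "size (enc_nat v) \<le> N"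
      using Cons by (auto simp: e enc_pair_Pair)
    show ?case unfolding enc_list.simps e enc_pair_Pair
      by (rule fn_intro, rule bodies, simp, (rule evb_rules fn_eq fn_mem IH size assms)+,
          use qs(1-4) in \<open>auto simp: touches_def enc_bool_def\<close>)
  qed
  show "length es < N"
    using assms(3) length_le_size_enc_list[of es "enc_pair enc_nat enc_nat"] by linarith
qed simp

lemma fn_count:
  assumes "size (enc_nat_pairs ucs) < N" "size (enc_nat c) \<le> N" "length S < N"
    "size (enc_nat_pairs es) < N"
  shows "fn COUNT [enc_nat_pairs ucs, enc_nat c, enc_nats S, enc_nat_pairs es]
    (un (count_touching ucs es c S)) (q 8)"
proof (rule fn_loop)
  show "fn COUNT [enc_nat_pairs ucs, enc_nat c, enc_nats S, enc_nat_pairs es]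
    (un (count_touching ucs es c S)) ((length ucs + 1) * q 7)"
    using assms(1)
  proof (induction ucs)
    case Nil
    show ?case unfolding enc_list.simps
      by (rule fn_intro, rule bodies, simp, (rule evb_rules)+,
          use qs(1-6) in \<open>auto simp: count_touching_def\<close>)
  next
    case (Cons uc ucs)
    obtain u c' where uc: "uc = (u, c')"
      by (cases uc)
    have IH: "fn COUNT [enc_nat_pairs ucs, enc_nat c, enc_nats S, enc_nat_pairs es]
        (un (count_touching ucs es c S)) ((length ucs + 1) * q 7)"
      and size: "size (enc_nat u) \<le> N"
      using Cons by (auto simp: uc enc_pair_Pair)
    show ?case unfolding enc_list.simps uc enc_pair_Pair
      by (rule fn_intro, rule bodies, simp, (rule evb_rules fn_eq fn_touch IH size assms)+,
          use qs(1-6) in \<open>auto simp: count_touching_def\<close>)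
  qed
  show "length ucs < N"
    using assms(1) length_le_size_enc_list[of ucs "enc_pair enc_nat enc_nat"] by linarith
qed simp

lemma fn_count_not:
  assumes "size (enc_nat_pairs ucs) < N" "size (enc_nat c) \<le> N" "length S < N"
    "size (enc_nat_pairs es) < N"
  shows "fn COUNT_NOT [enc_nat_pairs ucs, enc_nat c, enc_nats S, enc_nat_pairs es]
    (un (count_avoiding ucs es c S)) (q 8)"
proof (rule fn_loop)
  show "fn COUNT_NOT [enc_nat_pairs ucs, enc_nat c, enc_nats S, enc_nat_pairs es]
    (un (count_avoiding ucs es c S)) ((length ucs + 1) * q 7)"
    using assms(1)
  proof (induction ucs)
    case Nil
    show ?case unfolding enc_list.simps
      by (rule fn_intro, rule bodies, simp, (rule evb_rules)+,
          use qs(1-6) in \<open>auto simp: count_avoiding_def\<close>)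
  next
    case (Cons uc ucs)
    obtain u c' where uc: "uc = (u, c')"
      by (cases uc)
    have IH: "fn COUNT_NOT [enc_nat_pairs ucs, enc_nat c, enc_nats S, enc_nat_pairs es]
        (un (count_avoiding ucs es c S)) ((length ucs + 1) * q 7)"
      and size: "size (enc_nat u) \<le> N"
      using Cons by (auto simp: uc enc_pair_Pair)
    show ?case unfolding enc_list.simps uc enc_pair_Pair
      by (rule fn_intro, rule bodies, simp, (rule evb_rules fn_eq fn_touch IH size assms)+,
          use qs(1-6) in \<open>auto simp: count_avoiding_def\<close>)
  qed
  show "length ucs < N"
    using assms(1) length_le_size_enc_list[of ucs "enc_pair enc_nat enc_nat"] by linarith
qed simp

lemma fn_sub_times:
  assumes "n < N" "length S < N"
  shows "fn SUB_TIMES [un m, enc_list f S, un n] (un (m - n * length S)) (q 5)"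
proof (rule fn_loop[OF _ assms(2)])
  show "fn SUB_TIMES [un m, enc_list f S, un n] (un (m - n * length S)) ((length S + 1) * q 4)"
  proof (induction S arbitrary: m)
    case Nil
    show ?case unfolding enc_list.simps
      by (rule fn_intro, rule bodies, simp, (rule evb_rules)+, use qs(1-3) in auto)
  next
    case (Cons v S)
    show ?case unfolding enc_list.simps
      by (rule fn_intro, rule bodies, simp, (rule evb_rules fn_sub Cons assms)+,
          use qs(1-3) in auto)
  qed
qed simp

end


section \<open>The algorithm and its cost\<close>

lemma size_enc_list_subseq: "subseq xs ys \<Longrightarrow> size (enc_list f xs) \<le> size (enc_list f ys)"
  by (induction rule: list_emb.induct) auto

locale fair_input =
  fixes ucs :: "(nat \<times> nat) list" and vs :: "nat list" and es :: "(nat \<times> nat) list"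
    and cs :: "nat list" and l :: nat
begin

abbreviation (input) n :: nat where "n \<equiv> length ucs"
abbreviation (input) k :: nat where "k \<equiv> length vs"

definition code :: sexp where
  "code = Pair (enc_nat_pairs ucs) (Pair (enc_nats vs) (Pair (enc_nat_pairs es)
     (Pair (enc_nats cs) (enc_nat l))))"

definition isect :: "nat list \<Rightarrow> nat list \<Rightarrow> nat" where
  "isect S T = length (filter (\<lambda>v. v \<in> set T) S)"

text \<open>Capping \<open>l\<close>, which is given in binary, at \<open>n\<close> does not change the constraint and keeps the
  unary representation small.\<close>

definition lower :: "nat \<Rightarrow> nat list \<Rightarrow> nat" where
  "lower c S = count_avoiding ucs es c (filter (\<lambda>v. v \<notin> set S) vs) - min n l * length S"

text \<open>In a state \<open>(Z, vec)\<close>, \<open>Z\<close> contains the right vertices that still have to be covered by a set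
  \<open>T\<close>, and an entry \<open>(S, F, L)\<close> of \<open>vec\<close> stands for the constraint \<open>L \<le> m(S) < F\<close>. The operation
  \<open>Some c\<close> adds the constraints of color \<open>c\<close>; the operation \<open>None\<close> replaces \<open>m\<close> by \<open>m div 2\<close>, where
  \<open>T\<close> is the set on which \<open>m\<close> is odd.\<close>

definition step_entry ::
    "nat option \<Rightarrow> nat list \<Rightarrow> nat list \<times> nat \<times> nat \<Rightarrow> nat list \<times> nat \<times> nat" where
  "step_entry op T = (\<lambda>(S, F, L). (S, case op of
       None \<Rightarrow> ((F + 1 - isect S T) div 2, (L + 1 - isect S T) div 2)
     | Some c \<Rightarrow> (min F (count_touching ucs es c S + 1 - isect S T), max L (lower c S))))"

text \<open>The set guessed in a halving consists of digits of m and covers no vertex, so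
  \<open>Z\<close> shrinks only when a color is processed.\<close>

definition step :: "nat option \<Rightarrow> nat list \<Rightarrow> nat list \<times> (nat list \<times> nat \<times> nat) list \<Rightarrow>
    nat list \<times> (nat list \<times> nat \<times> nat) list" where
  "step op T = (\<lambda>(Z, vec). (if op = None then Z else filter (\<lambda>v. v \<notin> set T) Z,
     map (step_entry op T) vec))"

text \<open>For l = 0 no load may exceed m(v), so the empty set is the only admissible guess for a
  color.\<close>

definition choices :: "nat option \<Rightarrow> nat list list" where
  "choices op = (if op \<noteq> None \<and> l = 0 then [[]] else subseqs vs)"

definition expand where
  "expand op st = fold (\<lambda>T. List.insert (step op T st))"

definition expands where
  "expands op = fold (\<lambda>st. expand op st (choices op))"

definition iterate where
  "iterate = fold (\<lambda>op sts. expands op sts [])"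

text \<open>\<open>Z\<close> is a guess for the vertices where m may vanish: the constraints for
  singletons force m to be positive outside \<open>Z\<close>. The threshold n + 1 holds for every
  solution, since at least m(S) left vertices of each color have a neighbor in S.\<close>

definition init_vec :: "nat list \<Rightarrow> (nat list \<times> nat \<times> nat) list" where
  "init_vec Z = map (\<lambda>S. (S, n + 1, length (filter (\<lambda>v. v \<notin> set Z) S))) (subseqs vs)"

definition inits :: "(nat list \<times> (nat list \<times> nat \<times> nat) list) list" where
  "inits = map (\<lambda>Z. (Z, init_vec Z)) (subseqs vs)"

text \<open>Satisfaction by m = 0, the only candidate once all binary digits have been
  stripped.\<close>

definition good_vec :: "(nat list \<times> nat \<times> nat) list \<Rightarrow> bool" where
  "good_vec vec \<longleftrightarrow> (\<forall>(S, F, L)\<in>set vec. F \<noteq> 0 \<and> L = 0)"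

definition good :: "nat list \<times> (nat list \<times> nat \<times> nat) list \<Rightarrow> bool" where
  "good = (\<lambda>(Z, vec). Z = [] \<and> good_vec vec)"

text \<open>n halvings exhaust m, because m(v) \<le> n < 2^n in every solution; this keeps the
  number of rounds linear.\<close>

definition ops :: "nat option list" where
  "ops = map Some cs @ replicate n None"

definition accepts :: bool where
  "accepts \<longleftrightarrow> (\<exists>st\<in>set (iterate ops inits). good st)"

section \<open>Bounding the number of simultaneous states\<close>

definition wf_entry :: "nat list \<times> nat \<times> nat \<Rightarrow> bool" where
  "wf_entry = (\<lambda>(S, F, L). subseq S vs \<and> F \<le> n + 1 \<and> L \<le> n + k)"

definition close :: "nat list \<times> nat \<times> nat \<Rightarrow> nat list \<times> nat \<times> nat \<Rightarrow> bool" where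
  "close = (\<lambda>(S', F', L') (S, F, L). S = S' \<and> F \<le> F' \<and> F' \<le> F + k \<and> L \<le> L' \<and> L' \<le> L + k)"

text \<open>\<open>base\<close> will be the vector that is reached by always choosing the empty set.\<close>

definition near :: "(nat list \<times> nat \<times> nat) list \<Rightarrow> nat list \<times> (nat list \<times> nat \<times> nat) list \<Rightarrow> bool"
  where "near base = (\<lambda>(Z, vec). subseq Z vs \<and> list_all2 close base vec)"

definition wf_base :: "(nat list \<times> nat \<times> nat) list \<Rightarrow> bool" where
  "wf_base base \<longleftrightarrow> length base = 2 ^ k \<and> (\<forall>e\<in>set base. wf_entry e)"

definition wf_state :: "nat list \<times> (nat list \<times> nat \<times> nat) list \<Rightarrow> bool" where
  "wf_state = (\<lambda>(Z, vec). subseq Z vs \<and> wf_base vec)"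

text \<open>2^k candidates for \<open>Z\<close>, and for each of the 2^k subsets two offsets from
  the base thresholds, each between 0 and k. The bound does not depend on n.\<close>

definition num_states :: nat where
  "num_states = 2 ^ k * ((k + 1) ^ 2) ^ 2 ^ k"

lemma isect_le: "subseq S vs \<Longrightarrow> isect S T \<le> k"
  unfolding isect_def
  using length_filter_le[of "\<lambda>v. v \<in> set T" S] list_emb_length[of "(=)" S vs] by linarith

lemma count_touching_le: "count_touching ucs es c S \<le> n"
  by (simp add: count_touching_def)

lemma count_avoiding_le: "count_avoiding ucs es c S \<le> n"
  by (simp add: count_avoiding_def)

lemma lower_le: "lower c S \<le> n"
  unfolding lower_def by (rule le_trans[OF diff_le_self count_avoiding_le])

lemma wf_step_entry: "wf_entry e \<Longrightarrow> wf_entry (step_entry op T e)"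
  using le_trans[OF lower_le le_add1]
  by (cases op) (auto simp: wf_entry_def step_entry_def)

lemma wf_entry_close: "close e' e \<Longrightarrow> wf_entry e' \<Longrightarrow> wf_entry e"
  by (auto simp: close_def wf_entry_def)

text \<open>The offset bound k is invariant. For a color, the new upper thresholds differ by at most
  |S \<inter> T| \<le> k, the new lower threshold does not depend on T, and minimum and maximum do
  not enlarge offsets. For a halving, the old offset and |S \<inter> T| add up to at most 2k before
  division by 2, so errors do not accumulate over the rounds.\<close>

lemma close_step_entry:
  assumes "close e' e" "wf_entry e'"
  shows "close (step_entry op [] e') (step_entry op T e)"
proof -
  obtain S F L F' L' where e: "e = (S, F, L)" and e': "e' = (S, F', L')"
    using assms(1) by (cases e, cases e') (auto simp: close_def)
  have "isect S T \<le> k" "isect S [] = 0"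
    using assms(2) isect_le by (auto simp: e' wf_entry_def isect_def)
  then show ?thesis
    using assms(1) by (cases op) (auto simp: e e' close_def step_entry_def)
qed

lemma near_step:
  assumes "wf_base base" "near base st"
  shows "near (map (step_entry op []) base) (step op T st)"
proof -
  obtain Z vec where st: "st = (Z, vec)"
    by (cases st)
  have near: "subseq Z vs" "list_all2 close base vec"
    using assms(2) by (auto simp: near_def st)
  have "list_all2 close (map (step_entry op []) base) (map (step_entry op T) vec)"
    using near(2) assms(1) close_step_entry
    by (auto simp: list_all2_conv_all_nth wf_base_def)
  moreover have "subseq (filter P Z) vs" for P
    using near(1) subseq_filter_left subseq_order.order_trans by blast
  ultimately show ?thesis
    using near(1) by (simp add: near_def st step_def)
qed

lemma wf_base_step: "wf_base base \<Longrightarrow> wf_base (map (step_entry op T) base)"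
  using wf_step_entry by (auto simp: wf_base_def)

lemma wf_state_near:
  assumes "wf_base base" "near base st"
  shows "wf_state st"
proof -
  obtain Z vec where st: "st = (Z, vec)"
    by (cases st)
  have "wf_entry (vec ! i)" if "i < length vec" for i
    by (rule wf_entry_close[of "base ! i"])
      (use that assms in \<open>auto simp: st near_def list_all2_conv_all_nth wf_base_def\<close>)
  then have "\<forall>e\<in>set vec. wf_entry e"
    by (metis in_set_conv_nth)
  then show ?thesis
    using assms by (auto simp: st wf_state_def wf_base_def near_def list_all2_conv_all_nth)
qed

text \<open>A state near \<open>base\<close> is determined by \<open>Z\<close> and the list of
  offsets of its thresholds from those of \<open>base\<close>; such pairs are counted.\<close>

lemma card_near:
  assumes "wf_base base"
  shows "finite {st. near base st}" "card {st. near base st} \<le> num_states"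
proof -
  define D where "D = {ds. set ds \<subseteq> {..k} \<times> {..k} \<and> length ds = 2 ^ k}"
  define f where "f = (\<lambda>(Z, ds :: (nat \<times> nat) list).
    (Z :: nat list, map2 (\<lambda>(S :: nat list, F, L) (a, b). (S, F - a, L - b)) base ds))"
  have fin: "finite D"
    unfolding D_def by (rule finite_lists_length_eq) simp
  have card: "card D = ((k + 1) ^ 2) ^ 2 ^ k"
    unfolding D_def
    by (subst card_lists_length_eq) (auto simp: card_cartesian_product power2_eq_square)
  have sub: "{st. near base st} \<subseteq> f ` (set (subseqs vs) \<times> D)"
  proof
    fix st
    assume "st \<in> {st. near base st}"
    then obtain Z vec where st: "st = (Z, vec)" and Z: "subseq Z vs"
      and vec: "list_all2 close base vec"
      by (auto simp: near_def)
    define ds where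
      "ds = map2 (\<lambda>(S' :: nat list, F', L') (S :: nat list, F, L). (F' - F, L' - L)) base vec"
    have len: "length vec = length base"
      using vec list_all2_lengthD by metis
    have "set ds \<subseteq> {..k} \<times> {..k}"
    proof
      fix d
      assume "d \<in> set ds"
      then obtain i where "i < length vec" "d = ds ! i"
        by (auto simp: ds_def in_set_conv_nth len)
      then show "d \<in> {..k} \<times> {..k}"
        using list_all2_nthD2[OF vec, of i]
        by (auto simp: ds_def len close_def split: prod.splits)
    qed
    then have "ds \<in> D"
      using assms by (simp add: D_def ds_def len wf_base_def)
    \<comment> \<open>By \<open>close\<close> no threshold exceeds that of \<open>base\<close>, so
      truncated subtraction of the offsets recovers it exactly.\<close>
    moreover have "map2 (\<lambda>(S :: nat list, F, L) (a, b). (S, F - a, L - b)) base ds = vec"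
    proof (rule nth_equalityI)
      fix i
      assume "i < length (map2 (\<lambda>(S :: nat list, F, L) (a, b). (S, F - a, L - b)) base ds)"
      then have "i < length vec"
        by (simp add: ds_def len)
      then show "map2 (\<lambda>(S :: nat list, F, L) (a, b). (S, F - a, L - b)) base ds ! i = vec ! i"
        using list_all2_nthD2[OF vec, of i]
        by (auto simp: ds_def len close_def split: prod.splits)
    qed (simp add: ds_def len)
    ultimately show "st \<in> f ` (set (subseqs vs) \<times> D)"
      using Z by (intro image_eqI[of _ _ "(Z, ds)"]) (auto simp: st f_def)
  qed
  show "finite {st. near base st}"
    by (rule finite_subset[OF sub]) (use fin in simp)
  have "card {st. near base st} \<le> card (set (subseqs vs) \<times> D)"
    using fin by (intro surj_card_le[OF _ sub]) simp
  also have "\<dots> = card (set (subseqs vs)) * card D"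
    by (rule card_cartesian_product)
  also have "\<dots> \<le> length (subseqs vs) * card D"
    by (intro mult_le_mono1 card_length)
  finally show "card {st. near base st} \<le> num_states"
    by (simp add: length_subseqs card num_states_def)
qed

lemma set_expand: "set (expand op st Ts acc) = (\<lambda>T. step op T st) ` set Ts \<union> set acc"
  by (induction Ts arbitrary: acc) (auto simp: expand_def)

lemma distinct_expand: "distinct acc \<Longrightarrow> distinct (expand op st Ts acc)"
  by (induction Ts arbitrary: acc) (auto simp: expand_def)

lemma set_expands:
  "set (expands op sts acc) = {step op T st | T st. T \<in> set (choices op) \<and> st \<in> set sts} \<union> set acc"
  by (induction sts arbitrary: acc) (auto simp: expands_def set_expand)

lemma distinct_expands: "distinct acc \<Longrightarrow> distinct (expands op sts acc)"
  by (induction sts arbitrary: acc) (auto simp: expands_def distinct_expand)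

end

section \<open>Encoding of operations and states\<close>

fun enc_op :: "nat option \<Rightarrow> sexp" where
  "enc_op None = Null"
| "enc_op (Some c) = Pair (enc_nat c) Null"

fun enc_entry :: "nat list \<times> nat \<times> nat \<Rightarrow> sexp" where
  "enc_entry (S, F, L) = Pair (enc_nats S) (Pair (un F) (un L))"

fun enc_state :: "nat list \<times> (nat list \<times> nat \<times> nat) list \<Rightarrow> sexp" where
  "enc_state (Z, vec) = Pair (enc_nats Z) (enc_list enc_entry vec)"

lemma inj_enc_state: "inj enc_state"
proof -
  note inj_nats = inj_enc_list[OF inj_enc_nat]
  have "inj enc_entry"
    by (auto simp: inj_def inj_eq[OF inj_nats])
  then have "inj (enc_list enc_entry)"
    by (rule inj_enc_list)
  then show ?thesis
    by (auto simp: inj_def inj_eq[OF inj_nats] inj_eq)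
qed

lemma evb_Suc: "evb env e (un m) t \<Longrightarrow> evb env (SucE e) (un (Suc m)) (1 + t + 1)"
  unfolding un.simps by (intro evb_Pair evb_Null)

text \<open>N is chosen to exceed the length of every list of states and to bound the code of every
  single state: the factor 2^k + 1 accounts for the 2^k entries, each linear in the input size, and
  for \<open>Z\<close>.\<close>

locale bounded_fair_input = fair_input + cost_bound +
  assumes num_states_less: "num_states < N"
    and size_le: "(2 ^ length vs + 1) * (4 * size code + 50) \<le> N"
begin

lemma size_code: "4 * size code + 50 \<le> N" "2 ^ k < N"
proof -
  have "1 * (4 * size code + 50) \<le> (2 ^ k + 1) * (4 * size code + 50)"
    by (intro mult_le_mono1) simp
  then show "4 * size code + 50 \<le> N"
    unfolding mult_1 by (rule le_trans[OF _ size_le])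
  have "(2 ^ k + 1) * 1 \<le> (2 ^ k + 1) * (4 * size code + 50)"
    by (intro mult_le_mono2) simp
  then have "(2 ^ k + 1) * 1 \<le> N"
    by (rule le_trans[OF _ size_le])
  then show "2 ^ k < N"
    by simp
qed

lemma sizes:
  "size (enc_nat_pairs ucs) < N" "size (enc_nats vs) < N" "size (enc_nat_pairs es) < N"
  "size (enc_nats cs) < N" "size (enc_nat l) < N" "2 * n + 1 < N" "n < N" "k < N" "n + 2 < N"
  "length cs + n < N" "length cs < N" "n + k + 1 < N" "length (binary l) < N"
  using size_code(1) length_le_size_enc_list[of ucs "enc_pair enc_nat enc_nat"]
    length_le_size_enc_list[of vs enc_nat] length_le_size_enc_list[of cs enc_nat]
    length_le_size_enc_list[of "binary l" enc_bool]
  by (simp_all add: code_def enc_nat_def)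

lemma subseq_bounds:
  assumes "subseq S vs"
  shows "size (enc_nats S) < N" "length S < N"
  using size_enc_list_subseq[OF assms, of enc_nat] sizes(2) length_le_size_enc_list[of S enc_nat]
  by linarith+

lemma size_enc_state:
  assumes "wf_state st"
  shows "size (enc_state st) \<le> N"
proof -
  obtain Z vec where st: "st = (Z, vec)"
    by (cases st)
  have Z: "subseq Z vs" and vec: "length vec = 2 ^ k" "\<forall>e\<in>set vec. wf_entry e"
    using assms by (auto simp: wf_state_def wf_base_def st)
  have parts: "size (enc_nats vs) \<le> size code" "n \<le> size code" "k \<le> size code"
    using length_le_size_enc_list[of ucs "enc_pair enc_nat enc_nat"]
      length_le_size_enc_list[of vs enc_nat]
    by (simp_all add: code_def)
  \<comment> \<open>The code of S, the two occurrences of n and the one of k in F \<le> n + 1 and L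
    \<le> n + k are each at most \<open>size code\<close>.\<close>
  have entry: "size (enc_entry e) \<le> 4 * size code + 10" if "wf_entry e" for e
    using that parts size_enc_list_subseq[of "fst e" vs enc_nat]
    by (cases e) (auto simp: wf_entry_def)
  have "size (enc_list enc_entry vec) \<le> length vec * (4 * size code + 11)"
    using vec(2)
  proof (induction vec)
    case (Cons e vec)
    then show ?case using entry[of e] by simp
  qed simp
  moreover have "size (enc_nats Z) \<le> size code"
    using size_enc_list_subseq[OF Z, of enc_nat] parts(1) by linarith
  moreover have "2 ^ k * (4 * size code + 11) + size code + 1 \<le> (2 ^ k + 1) * (4 * size code + 50)"
    by (simp add: algebra_simps)
  ultimately show ?thesis
    using size_le by (simp add: st vec(1))
qed

section \<open>Cost of a single transition\<close>

lemma fn_step_entry: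
  assumes "wf_entry e" "subseq T vs" "set_option op \<subseteq> set cs"
  shows "fn STEP_ENTRY [enc_entry e, enc_op op, enc_nats T, code]
    (enc_entry (step_entry op T e)) (q 9)"
proof -
  obtain S F L where e: "e = (S, F, L)"
    by (cases e)
  have S: "subseq S vs" and F: "F < N" "L < N" "Suc F < N" "Suc L < N"
    using assms(1) sizes by (auto simp: e wf_entry_def)
  have inter: "length (filter (\<lambda>v. v \<in> set T) S) < N"
    using isect_le[OF S, of T] sizes(8) by (simp add: isect_def)
  have diffs: "F - i < N" "L - i < N" "Suc F - i < N" "Suc L - i < N" for i
    using F by auto
  note bounds = subseq_bounds[OF S] subseq_bounds[OF assms(2)] sizes F inter diffs inj_enc_nat
  show ?thesis
  proof (cases op)
    case None
    show ?thesis unfolding e None enc_entry.simps enc_op.simps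
      by (rule fn_intro, rule bodies, simp,
          (rule evb_Suc evb_rules fn_half fn_sub fn_inter bounds)+,
          use qs(1-8) in \<open>auto simp: step_entry_def isect_def\<close>)
  next
    case (Some c)
    have c: "size (enc_nat c) \<le> N"
      using size_le_size_enc_list[of c cs enc_nat] assms(3) sizes(4) by (simp add: Some)
    have counts: "Suc (count_touching ucs es c S) - i < N"
      "count_avoiding ucs es c S' - i < N" for S' i
      using count_touching_le[of c S] count_avoiding_le[of c S'] sizes(9) by linarith+
    have len: "length (filter P vs) < N" for P
      using length_filter_le[of P vs] sizes(8) by linarith
    have cap: "capped n (binary l) = min n l" "capped n (binary l) < N"
      using sizes(7) by (simp_all add: capped_eq binary_value_binary)
    \<comment> \<open>The code of l is unfolded into its digits, since \<open>CAP\<close> works on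
      the binary expansion.\<close>
    show ?thesis unfolding e Some enc_entry.simps enc_op.simps code_def enc_nat_def[of l]
      by (rule fn_intro, rule bodies, simp,
          (rule evb_Suc evb_rules fn_min fn_max fn_sub fn_inter fn_count fn_count_not fn_diff
            fn_sub_times fn_cap fn_len bounds c counts len cap)+,
          use qs(1-8) in \<open>auto simp: step_entry_def isect_def lower_def cap(1)\<close>)
  qed
qed

lemma fn_step_vec:
  assumes "\<forall>e\<in>set vec. wf_entry e" "length vec < N" "subseq T vs"
    "set_option op \<subseteq> set cs"
  shows "fn STEP_VEC [enc_list enc_entry vec, enc_op op, enc_nats T, code]
    (enc_list enc_entry (map (step_entry op T) vec)) (q 11)"
proof (rule fn_loop[OF _ assms(2)])
  show "fn STEP_VEC [enc_list enc_entry vec, enc_op op, enc_nats T, code]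
    (enc_list enc_entry (map (step_entry op T) vec)) ((length vec + 1) * q 10)"
    using assms(1)
  proof (induction vec)
    case Nil
    show ?case unfolding enc_list.simps
      by (rule fn_intro, rule bodies, simp, (rule evb_rules)+, use qs(1-9) in auto)
  next
    case (Cons e vec)
    then have IH: "fn STEP_VEC [enc_list enc_entry vec, enc_op op, enc_nats T, code]
        (enc_list enc_entry (map (step_entry op T) vec)) ((length vec + 1) * q 10)"
      and e: "wf_entry e"
      by auto
    show ?case unfolding enc_list.simps
      by (rule fn_intro, rule bodies, simp,
          (rule evb_rules IH fn_step_entry[OF e assms(3,4)])+, use qs(1-9) in auto)
  qed
qed simp

lemma fn_step:
  assumes "wf_state st" "subseq T vs" "set_option op \<subseteq> set cs"
  shows "fn STEP [enc_state st, enc_op op, enc_nats T, code] (enc_state (step op T st)) (q 12)"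
proof -
  obtain Z vec where st: "st = (Z, vec)"
    by (cases st)
  have Z: "subseq Z vs" and vec: "length vec < N" "\<forall>e\<in>set vec. wf_entry e"
    using assms(1) size_code(2) by (auto simp: wf_state_def wf_base_def st)
  note rules = fn_step_vec[OF vec(2,1) assms(2,3)] fn_diff inj_enc_nat
    subseq_bounds[OF Z] subseq_bounds[OF assms(2)]
  show ?thesis
  proof (cases op)
    case None
    show ?thesis unfolding st enc_state.simps None enc_op.simps
      by (rule fn_intro, rule bodies, simp, (rule evb_rules rules[unfolded None enc_op.simps])+,
          use qs(1-11) in \<open>auto simp: step_def\<close>)
  next
    case (Some c)
    show ?thesis unfolding st enc_state.simps Some enc_op.simps
      by (rule fn_intro, rule bodies, simp, (rule evb_rules rules[unfolded Some enc_op.simps])+,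
          use qs(1-11) in \<open>auto simp: step_def\<close>)
  qed
qed

lemma fn_insert:
  assumes "size (enc_state st) \<le> N" "length acc < N"
  shows "fn INSERT [enc_state st, enc_list enc_state acc]
    (enc_list enc_state (List.insert st acc)) (q 5)"
  by (rule fn_intro, rule bodies, simp, (rule evb_rules fn_mem assms)+,
      use qs(1-4) in \<open>auto simp: inj_image_mem_iff[OF inj_enc_state]\<close>)

lemma fn_choices: "fn CHOICES [enc_op op, code] (enc_list enc_nats (choices op)) (q 7)"
proof (cases op)
  case None
  show ?thesis unfolding None enc_op.simps code_def
    by (rule fn_intro, rule bodies, simp, (rule evb_rules fn_subseqs size_code(2))+,
        use qs(1-6) in \<open>auto simp: choices_def\<close>)
next
  case (Some c)
  show ?thesis
  proof (cases "l = 0")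
    case True
    then have choices: "choices (Some c) = [[]]"
      unfolding choices_def by simp
    from True have l: "enc_nat l = Null"
      by (simp add: enc_nat_def binary.simps[of 0])
    show ?thesis unfolding Some enc_op.simps code_def l
      by (rule fn_intro, rule bodies, simp, (rule evb_rules)+, use qs(1-6) choices in auto)
  next
    case False
    then have l: "enc_nat l = Pair (enc_bool (odd l)) (enc_nat (l div 2))"
      by (simp add: enc_nat_def binary.simps[of l])
    show ?thesis unfolding Some enc_op.simps code_def l
      by (rule fn_intro, rule bodies, simp, (rule evb_rules fn_subseqs size_code(2))+,
        use qs(1-6) False in \<open>auto simp: choices_def\<close>)
  qed
qed

section \<open>Cost of exploring the state space\<close>

lemma length_near:
  assumes "wf_base base" "\<forall>st\<in>set sts. near base st" "distinct sts"
  shows "length sts < N"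
proof -
  have "length sts \<le> card {st. near base st}"
    using assms by (subst distinct_card[symmetric]) (auto intro!: card_mono card_near)
  also have "\<dots> \<le> num_states"
    by (rule card_near[OF assms(1)])
  finally show ?thesis
    using num_states_less by simp
qed

lemma choices_subseq: "T \<in> set (choices op) \<Longrightarrow> subseq T vs"
  by (auto simp: choices_def split: if_splits)

lemma length_choices: "length (choices op) < N"
  using size_code(2) N by (auto simp: choices_def length_subseqs)

text \<open>The accumulator remains a duplicate-free list of states near the advanced base, hence
  stays shorter than N at every insertion, whichever states have contributed to it.\<close>

lemma fn_expand:
  assumes "wf_base base" "near base st" "set_option op \<subseteq> set cs"
    "\<forall>T\<in>set Ts. subseq T vs" "length Ts < N"
    "\<forall>st'\<in>set acc. near (map (step_entry op []) base) st'" "distinct acc"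
  shows "fn EXPAND [enc_list enc_nats Ts, enc_state st, enc_list enc_state acc, enc_op op, code]
    (enc_list enc_state (expand op st Ts acc)) (q 14)"
proof (rule fn_loop[OF _ assms(5)])
  show "fn EXPAND [enc_list enc_nats Ts, enc_state st, enc_list enc_state acc, enc_op op, code]
    (enc_list enc_state (expand op st Ts acc)) ((length Ts + 1) * q 13)"
    using assms(4,6,7)
  proof (induction Ts arbitrary: acc)
    case Nil
    show ?case unfolding enc_list.simps
      by (rule fn_intro, rule bodies, simp, (rule evb_rules)+,
          use qs(1-12) in \<open>auto simp: expand_def\<close>)
  next
    case (Cons T Ts)
    have T: "subseq T vs"
      using Cons.prems by simp
    have near: "near (map (step_entry op []) base) (step op T st)"
      by (rule near_step[OF assms(1,2)])
    have len: "length acc < N"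
      by (rule length_near[OF wf_base_step Cons.prems(2,3)]) fact
    have IH: "fn EXPAND [enc_list enc_nats Ts, enc_state st,
        enc_list enc_state (List.insert (step op T st) acc), enc_op op, code]
        (enc_list enc_state (expand op st Ts (List.insert (step op T st) acc)))
        ((length Ts + 1) * q 13)"
      using Cons.prems near by (intro Cons.IH) auto
    note rules = IH fn_step[OF wf_state_near[OF assms(1,2)] T assms(3)]
      fn_insert[OF size_enc_state[OF wf_state_near[OF wf_base_step[OF assms(1)] near]] len]
    show ?case unfolding enc_list.simps
      by (rule fn_intro, rule bodies, simp, (rule evb_rules rules)+,
          use qs(1-12) in \<open>auto simp: expand_def\<close>)
  qed
qed simp

lemma fn_expands:
  assumes "wf_base base" "\<forall>st\<in>set sts. near base st" "set_option op \<subseteq> set cs"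
    "length sts < N"
    "\<forall>st'\<in>set acc. near (map (step_entry op []) base) st'" "distinct acc"
  shows "fn EXPANDS [enc_list enc_state sts, enc_list enc_state acc, enc_op op, code]
    (enc_list enc_state (expands op sts acc)) (q 16)"
proof (rule fn_loop[OF _ assms(4)])
  show "fn EXPANDS [enc_list enc_state sts, enc_list enc_state acc, enc_op op, code]
    (enc_list enc_state (expands op sts acc)) ((length sts + 1) * q 15)"
    using assms(2,5,6)
  proof (induction sts arbitrary: acc)
    case Nil
    show ?case unfolding enc_list.simps
      by (rule fn_intro, rule bodies, simp, (rule evb_rules)+,
          use qs(1-14) in \<open>auto simp: expands_def\<close>)
  next
    case (Cons st sts)
    have st: "near base st" and Ts: "\<forall>T\<in>set (choices op). subseq T vs"
      using Cons.prems choices_subseq by auto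
    have IH: "fn EXPANDS [enc_list enc_state sts,
        enc_list enc_state (expand op st (choices op) acc), enc_op op, code]
        (enc_list enc_state (expands op sts (expand op st (choices op) acc)))
        ((length sts + 1) * q 15)"
      using Cons.prems near_step[OF assms(1) st]
      by (intro Cons.IH) (auto simp: set_expand distinct_expand)
    note rules = IH fn_choices
      fn_expand[OF assms(1) st assms(3) Ts length_choices Cons.prems(2,3)]
    show ?case unfolding enc_list.simps
      by (rule fn_intro, rule bodies, simp, (rule evb_rules rules)+,
          use qs(1-14) in \<open>auto simp: expands_def\<close>)
  qed
qed simp

text \<open>The base advances with each operation, by the empty choice, so every round obeys the
  same bound on the number of states. The two further conclusions supply the premises for the final
  check.\<close>

lemma fn_iterate:
  assumes "wf_base base" "\<forall>st\<in>set sts. near base st" "\<forall>op\<in>set ps. set_option op \<subseteq> set cs"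
    "length sts < N" "length ps < N"
  shows "fn ITERATE [enc_list enc_op ps, enc_list enc_state sts, code]
      (enc_list enc_state (iterate ps sts)) (q 18)" (is ?fn)
    and "length (iterate ps sts) < N" (is ?len)
    and "\<forall>st\<in>set (iterate ps sts). wf_state st" (is ?wf)
proof -
  have "fn ITERATE [enc_list enc_op ps, enc_list enc_state sts, code]
      (enc_list enc_state (iterate ps sts)) ((length ps + 1) * q 17) \<and> ?len \<and> ?wf"
    using assms(1-4)
  proof (induction ps arbitrary: base sts)
    case Nil
    have "fn ITERATE [enc_list enc_op [], enc_list enc_state sts, code]
      (enc_list enc_state (iterate [] sts)) ((length [] + 1) * q 17)"
      unfolding enc_list.simps
      by (rule fn_intro, rule bodies, simp, (rule evb_rules)+,
          use qs(1-16) in \<open>auto simp: iterate_def\<close>)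
    then show ?case
      using Nil wf_state_near by (auto simp: iterate_def)
  next
    case (Cons op ps)
    let ?base = "map (step_entry op []) base"
    have op: "set_option op \<subseteq> set cs"
      using Cons.prems by simp
    have near: "\<forall>st\<in>set (expands op sts []). near ?base st"
      using Cons.prems near_step by (auto simp: set_expands)
    have base: "wf_base ?base"
      using Cons.prems wf_base_step by simp
    have len: "length (expands op sts []) < N"
      by (rule length_near[OF base near]) (simp add: distinct_expands)
    have IH: "fn ITERATE [enc_list enc_op ps, enc_list enc_state (expands op sts []), code]
        (enc_list enc_state (iterate ps (expands op sts []))) ((length ps + 1) * q 17)"
      "length (iterate ps (expands op sts [])) < N"
      "\<forall>st\<in>set (iterate ps (expands op sts [])). wf_state st"
      using Cons.IH[OF base near _ len] Cons.prems by auto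
    have "fn EXPANDS [enc_list enc_state sts, Null, enc_op op, code]
        (enc_list enc_state (expands op sts [])) (q 16)"
      using fn_expands[OF Cons.prems(1,2) op Cons.prems(4), of "[]"] by simp
    note rules = IH(1) this
    have "fn ITERATE [enc_list enc_op (op # ps), enc_list enc_state sts, code]
      (enc_list enc_state (iterate (op # ps) sts)) ((length (op # ps) + 1) * q 17)"
      unfolding enc_list.simps
      by (rule fn_intro, rule bodies, simp, (rule evb_rules rules)+,
          use qs(1-16) in \<open>auto simp: iterate_def\<close>)
    then show ?case
      using IH(2,3) by (simp add: iterate_def)
  qed
  then show ?fn ?len ?wf
    using fn_loop[OF _ assms(5), of _ _ _ 17 18] by auto
qed

section \<open>Cost of initialization, final check and the whole program\<close>

lemma enc_op_None: "un m = enc_list enc_op (replicate m None)"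
  by (induction m) auto

lemma fn_ops:
  assumes "length ds < N"
  shows "fn OPS [enc_nats ds, un m] (enc_list enc_op (map Some ds @ replicate m None)) (q 3)"
proof (rule fn_loop[OF _ assms])
  show "fn OPS [enc_nats ds, un m] (enc_list enc_op (map Some ds @ replicate m None))
    ((length ds + 1) * q 2)"
  proof (induction ds)
    case Nil
    show ?case unfolding enc_list.simps
      by (rule fn_intro, rule bodies, simp, (rule evb_rules)+,
          use qs(1) in \<open>auto simp: enc_op_None\<close>)
  next
    case (Cons d ds)
    show ?case unfolding enc_list.simps
      by (rule fn_intro, rule bodies, simp, (rule evb_rules Cons)+, use qs(1) in auto)
  qed
qed simp

lemma fn_init_vec:
  assumes "\<forall>S\<in>set Ss. subseq S vs" "length Ss < N" "subseq Z vs"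
  shows "fn INIT_VEC [enc_list enc_nats Ss, enc_nats Z, code]
    (enc_list enc_entry (map (\<lambda>S. (S, n + 1, length (filter (\<lambda>v. v \<notin> set Z) S))) Ss)) (q 8)"
proof (rule fn_loop[OF _ assms(2)])
  show "fn INIT_VEC [enc_list enc_nats Ss, enc_nats Z, code]
    (enc_list enc_entry (map (\<lambda>S. (S, n + 1, length (filter (\<lambda>v. v \<notin> set Z) S))) Ss))
    ((length Ss + 1) * q 7)"
    using assms(1)
  proof (induction Ss)
    case Nil
    show ?case unfolding enc_list.simps
      by (rule fn_intro, rule bodies, simp, (rule evb_rules)+, use qs(1-6) in auto)
  next
    case (Cons S Ss)
    then have IH: "fn INIT_VEC [enc_list enc_nats Ss, enc_nats Z, code]
      (enc_list enc_entry (map (\<lambda>S. (S, n + 1, length (filter (\<lambda>v. v \<notin> set Z) S))) Ss))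
      ((length Ss + 1) * q 7)" and S: "subseq S vs"
      by auto
    have len: "length (filter P S) < N" for P
      using length_filter_le[of P S] subseq_bounds(2)[OF S] by linarith
    note rules = IH[unfolded code_def] fn_len fn_diff len inj_enc_nat
      subseq_bounds[OF S] subseq_bounds[OF assms(3)] sizes
    show ?case unfolding enc_list.simps code_def
      by (rule fn_intro, rule bodies, simp, (rule evb_Suc evb_rules rules)+, use qs(1-6) in auto)
  qed
qed simp

lemma fn_inits:
  assumes "\<forall>Z\<in>set Zs. subseq Z vs" "length Zs < N"
  shows "fn INITS [enc_list enc_nats Zs, code]
    (enc_list enc_state (map (\<lambda>Z. (Z, init_vec Z)) Zs)) (q 10)"
proof (rule fn_loop[OF _ assms(2)])
  show "fn INITS [enc_list enc_nats Zs, code]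
    (enc_list enc_state (map (\<lambda>Z. (Z, init_vec Z)) Zs)) ((length Zs + 1) * q 9)"
    using assms(1)
  proof (induction Zs)
    case Nil
    show ?case unfolding enc_list.simps
      by (rule fn_intro, rule bodies, simp, (rule evb_rules)+, use qs(1-8) in auto)
  next
    case (Cons Z Zs)
    then have IH: "fn INITS [enc_list enc_nats Zs, code]
      (enc_list enc_state (map (\<lambda>Z. (Z, init_vec Z)) Zs)) ((length Zs + 1) * q 9)"
      and Z: "subseq Z vs"
      by auto
    have "fn INIT_VEC [enc_list enc_nats (subseqs vs), enc_nats Z, code]
        (enc_list enc_entry (init_vec Z)) (q 8)"
      unfolding init_vec_def
      by (rule fn_init_vec[OF _ _ Z]) (use size_code(2) in \<open>auto simp: length_subseqs\<close>)
    note rules = IH[unfolded code_def] this[unfolded code_def] fn_subseqs[OF size_code(2)]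
    show ?case unfolding enc_list.simps code_def
      by (rule fn_intro, rule bodies, simp, (rule evb_rules rules)+, use qs(1-8) in auto)
  qed
qed simp

lemma fn_check_vec:
  assumes "length vec < N"
  shows "fn CHECK_VEC [enc_list enc_entry vec] (enc_bool (good_vec vec)) (q 3)"
proof (rule fn_loop[OF _ assms])
  show "fn CHECK_VEC [enc_list enc_entry vec] (enc_bool (good_vec vec)) ((length vec + 1) * q 2)"
  proof (induction vec)
    case Nil
    show ?case unfolding enc_list.simps
      by (rule fn_intro, rule bodies, simp, (rule evb_rules)+,
          use qs(1) in \<open>auto simp: good_vec_def enc_bool_def\<close>)
  next
    case (Cons e vec)
    obtain S F L where e: "e = (S, F, L)"
      by (cases e)
    show ?case
    proof (cases F)
      case F: 0
      show ?thesis unfolding e F enc_list.simps enc_entry.simps un.simps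
        by (rule fn_intro, rule bodies, simp, (rule evb_rules Cons)+,
            use qs(1) in \<open>auto simp: good_vec_def enc_bool_def\<close>)
    next
      case F: (Suc F')
      show ?thesis
      proof (cases L)
        case L: 0
        show ?thesis unfolding e F L enc_list.simps enc_entry.simps un.simps
          by (rule fn_intro, rule bodies, simp, (rule evb_rules Cons)+,
              use qs(1) in \<open>auto simp: good_vec_def enc_bool_def\<close>)
      next
        case L: (Suc L')
        show ?thesis unfolding e F L enc_list.simps enc_entry.simps un.simps
          by (rule fn_intro, rule bodies, simp, (rule evb_rules Cons)+,
              use qs(1) in \<open>auto simp: good_vec_def enc_bool_def\<close>)
      qed
    qed
  qed
qed simp

lemma fn_check:
  assumes "\<forall>st\<in>set sts. wf_state st" "length sts < N"
  shows "fn CHECK [enc_list enc_state sts] (enc_bool (\<exists>st\<in>set sts. good st)) (q 5)"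
proof (rule fn_loop[OF _ assms(2)])
  show "fn CHECK [enc_list enc_state sts] (enc_bool (\<exists>st\<in>set sts. good st))
    ((length sts + 1) * q 4)"
    using assms(1)
  proof (induction sts)
    case Nil
    show ?case unfolding enc_list.simps
      by (rule fn_intro, rule bodies, simp, (rule evb_rules)+,
          use qs(1-3) in \<open>auto simp: enc_bool_def\<close>)
  next
    case (Cons st sts)
    obtain Z vec where st: "st = (Z, vec)"
      by (cases st)
    have IH: "fn CHECK [enc_list enc_state sts] (enc_bool (\<exists>st\<in>set sts. good st))
      ((length sts + 1) * q 4)" and vec: "length vec < N"
      using Cons size_code(2) by (auto simp: st wf_state_def wf_base_def)
    show ?case
    proof (cases Z)
      case Z: Nil
      show ?thesis unfolding st Z enc_list.simps enc_state.simps
        by (rule fn_intro, rule bodies, simp, (rule evb_rules IH fn_check_vec[OF vec])+,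
            use qs(1-3) in \<open>auto simp: good_def enc_bool_def\<close>)
    next
      case Z: (Cons z Z')
      show ?thesis unfolding st Z enc_list.simps enc_state.simps
        by (rule fn_intro, rule bodies, simp, (rule evb_rules IH)+,
            use qs(1-3) in \<open>auto simp: good_def enc_bool_def\<close>)
    qed
  qed
qed simp

lemma fn_main: "fn 0 [code] (enc_bool accepts) (q 20)"
proof -
  \<comment> \<open>This is the initial vector for empty \<open>Z\<close>. Its lower thresholds |S|
    are the largest ones and exceed those for any other \<open>Z\<close> by at most k.\<close>
  define base where "base = map (\<lambda>S. (S, n + 1, length S)) (subseqs vs)"
  have base: "wf_base base"
    using list_emb_length[of "(=)" _ vs]
    by (auto simp: base_def wf_base_def wf_entry_def length_subseqs intro: trans_le_add2)
  have near: "\<forall>st\<in>set inits. near base st"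
    using list_emb_length[of "(=)" _ vs]
    by (auto simp: inits_def init_vec_def base_def near_def close_def list_all2_conv_all_nth
        intro: trans_le_add2 dest!: nth_mem)
  have ps: "\<forall>op\<in>set ops. set_option op \<subseteq> set cs" "length ops < N"
    using sizes(10) by (auto simp: ops_def)
  have inits: "length inits < N"
    using size_code(2) by (simp add: inits_def length_subseqs)
  have fn_inits: "fn INITS [enc_list enc_nats (subseqs vs), code] (enc_list enc_state inits) (q 10)"
    unfolding inits_def by (rule fn_inits) (use size_code(2) in \<open>auto simp: length_subseqs\<close>)
  note iterate = fn_iterate[OF base near ps(1) inits ps(2)]
  note rules = fn_inits[unfolded code_def] iterate(1)[unfolded code_def ops_def]
    fn_check[OF iterate(3,2)[unfolded ops_def]]
    fn_ops[OF sizes(11)] fn_len[OF sizes(7)] fn_subseqs[OF size_code(2)]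
  show ?thesis unfolding code_def
    by (rule fn_intro, rule bodies, simp, (rule evb_rules rules)+,
        use qs(1-19) in \<open>auto simp: accepts_def ops_def\<close>)
qed

end


section \<open>Assignments with prescribed ranges of loads\<close>

definition load :: "('x \<Rightarrow> 'v) \<Rightarrow> 'x set \<Rightarrow> 'v \<Rightarrow> nat" where
  "load \<mu> X v = card {x \<in> X. \<mu> x = v}"

text \<open>The additive form avoids truncated subtraction and lets the changes along a path
  telescope.\<close>

lemma load_fun_upd:
  assumes "finite X" "x \<in> X" "\<mu> x \<noteq> w"
  shows "load (\<mu>(x := w)) X y + of_bool (y = \<mu> x) = load \<mu> X y + of_bool (y = w)"
proof -
  have fin: "finite {x' \<in> X. \<mu> x' = z}" for z
    using assms(1) by simp
  consider "y = w" | "y = \<mu> x" | "y \<noteq> w" "y \<noteq> \<mu> x" by blast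
  then show ?thesis
  proof cases
    case 1
    have "{x' \<in> X. (\<mu>(x := w)) x' = w} = insert x {x' \<in> X. \<mu> x' = w}"
      using assms by auto
    then show ?thesis
      using 1 assms fin by (simp add: load_def)
  next
    case 2
    have "{x' \<in> X. \<mu> x' = \<mu> x} = insert x {x' \<in> X. (\<mu>(x := w)) x' = \<mu> x}"
      using assms by auto
    then show ?thesis
      using 2 assms by (simp add: load_def)
  next
    case 3
    then have "{x' \<in> X. (\<mu>(x := w)) x' = y} = {x' \<in> X. \<mu> x' = y}"
      by auto
    then show ?thesis
      using 3 by (simp only: load_def)
  qed
qed

lemma sum_load:
  assumes "finite X" "finite R"
  shows "(\<Sum>w\<in>R. load \<mu> X w) = card {x \<in> X. \<mu> x \<in> R}"
proof -
  have "{x \<in> X. \<mu> x \<in> R} = (\<Union>w\<in>R. {x \<in> X. \<mu> x = w})"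
    by auto
  then show ?thesis
    using assms by (simp add: load_def card_UN_disjoint disjoint_iff)
qed

text \<open>The arcs of the exchange graph of an assignment, whose paths play the role of augmenting
  paths.\<close>

definition can_move :: "('x \<Rightarrow> 'v set) \<Rightarrow> 'x set \<Rightarrow> ('x \<Rightarrow> 'v) \<Rightarrow> 'v \<Rightarrow> 'v \<Rightarrow> bool" where
  "can_move A X \<mu> v w \<longleftrightarrow> (\<exists>x\<in>X. \<mu> x = v \<and> w \<in> A x)"

text \<open>One element is moved along each arc, and the loads of inner vertices cancel. The clause
  on elements located off the path is the invariant that lets the first arc be used after the rest
  of the path has been rerouted.\<close>

lemma reroute_path:
  assumes "rtrancl_path (can_move A X \<mu>) v ws w" "distinct (v # ws)" "finite X" "\<forall>x\<in>X. \<mu> x \<in> A x"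
  shows "\<exists>\<mu>'. (\<forall>x\<in>X. \<mu>' x \<in> A x) \<and> (\<forall>x\<in>X. \<mu> x \<notin> set (v # ws) \<longrightarrow> \<mu>' x = \<mu> x) \<and>
    (\<forall>y. load \<mu>' X y + of_bool (y = v) = load \<mu> X y + of_bool (y = w))"
  using assms(1,2)
proof (induction rule: rtrancl_path.induct)
  case (base v)
  then show ?case
    using assms(4) by (intro exI[of _ \<mu>]) simp
next
  case (step v z ws w)
  obtain \<mu>' where \<mu>': "\<forall>x\<in>X. \<mu>' x \<in> A x" "\<forall>x\<in>X. \<mu> x \<notin> set (z # ws) \<longrightarrow> \<mu>' x = \<mu> x"
    "\<And>y. load \<mu>' X y + of_bool (y = z) = load \<mu> X y + of_bool (y = w)"
    using step by auto
  obtain x where x: "x \<in> X" "\<mu> x = v" "z \<in> A x"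
    using step.hyps(1) by (auto simp: can_move_def)
  \<comment> \<open>The path is simple, so \<open>v\<close> does not occur in its remainder and
    rerouting that has left \<open>x\<close> in place.\<close>
  have x': "\<mu>' x = v"
    using \<mu>'(2) x step.prems by auto
  have "load (\<mu>'(x := z)) X y + of_bool (y = v) = load \<mu> X y + of_bool (y = w)" for y
  proof -
    have "load (\<mu>'(x := z)) X y + of_bool (y = v) = load \<mu>' X y + of_bool (y = z)"
      using load_fun_upd[OF assms(3) x(1), of \<mu>' z y] step.prems by (auto simp: x')
    then show ?thesis
      using \<mu>'(3) by simp
  qed
  moreover have "\<forall>x'\<in>X. (\<mu>'(x := z)) x' \<in> A x'"
    using \<mu>'(1) x by simp
  moreover have "\<forall>x'\<in>X. \<mu> x' \<notin> set (v # z # ws) \<longrightarrow> (\<mu>'(x := z)) x' = \<mu> x'"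
    using \<mu>'(2) x by auto
  ultimately show ?case
    by blast
qed

lemma reroute:
  assumes "(can_move A X \<mu>)\<^sup>*\<^sup>* v w" "finite X" "\<forall>x\<in>X. \<mu> x \<in> A x"
  obtains \<mu>' where "\<forall>x\<in>X. \<mu>' x \<in> A x"
    "\<And>y. load \<mu>' X y + of_bool (y = v) = load \<mu> X y + of_bool (y = w)"
proof -
  obtain ws where "rtrancl_path (can_move A X \<mu>) v ws w"
    using assms(1) by (auto simp: rtranclp_eq_rtrancl_path)
  then obtain ws' where "rtrancl_path (can_move A X \<mu>) v ws' w" "distinct (v # ws')"
    by (rule rtrancl_path_distinct)
  from reroute_path[OF this assms(2,3)] show thesis
    using that by blast
qed

text \<open>A valid assignment of minimum total violation violates no bound: from an overloaded \<open>v\<close> no vertex with spare room is reachable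
  by moves, so the set of reachable vertices contradicts the upper condition; dually for an
  underloaded \<open>v\<close> and the vertices from which it is reachable.\<close>

theorem assignment_with_bounded_loads:
  fixes a b :: "'v \<Rightarrow> nat"
  assumes "finite X" "finite V" and AV: "\<And>x. x \<in> X \<Longrightarrow> A x \<subseteq> V"
    and ab: "\<And>v. v \<in> V \<Longrightarrow> a v \<le> b v"
    and lower: "\<And>S. S \<subseteq> V \<Longrightarrow> sum a S \<le> card {x \<in> X. A x \<inter> S \<noteq> {}}"
    and upper: "\<And>S. S \<subseteq> V \<Longrightarrow> card {x \<in> X. A x \<subseteq> S} \<le> sum b S"
  obtains \<mu> where "\<forall>x\<in>X. \<mu> x \<in> A x" "\<forall>v\<in>V. a v \<le> load \<mu> X v \<and> load \<mu> X v \<le> b v"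
proof -
  define viol where
    "viol \<mu> = (\<Sum>v\<in>V. (a v - load \<mu> X v) + (load \<mu> X v - b v))" for \<mu>
  define valid where "valid \<mu> \<longleftrightarrow> (\<forall>x\<in>X. \<mu> x \<in> A x)" for \<mu>
  \<comment> \<open>The upper condition for the empty set forbids elements without options.\<close>
  have "A x \<noteq> {}" if "x \<in> X" for x
    using upper[of "{}"] that assms(1) by auto
  then have "valid (\<lambda>x. SOME v. v \<in> A x)"
    by (auto simp: valid_def some_in_eq)
  then obtain \<mu> where valid: "valid \<mu>" and least: "\<And>\<mu>'. valid \<mu>' \<Longrightarrow> viol \<mu> \<le> viol \<mu>'"
    using ex_has_least_nat[of valid _ viol] by blast
  note valid' = valid[unfolded valid_def]
  let ?R = "(can_move A X \<mu>)\<^sup>*\<^sup>*"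
  \<comment> \<open>Moving one unit from \<open>v\<close> to \<open>w\<close> creates no violation,
    since \<open>v\<close> stays at or above \<open>a v\<close> and \<open>w\<close> at or below
    \<open>b w\<close>; it lessens the excess at \<open>v\<close> or the deficit at
    \<open>w\<close>, against minimality.\<close>
  have no_improvement: False
    if h: "?R v w" "v \<in> V" "w \<in> V" "a v < load \<mu> X v" "load \<mu> X w < b w"
      "b v < load \<mu> X v \<or> load \<mu> X w < a w" for v w
  proof -
    obtain \<mu>' where \<mu>': "\<forall>x\<in>X. \<mu>' x \<in> A x"
      "\<And>y. load \<mu>' X y + of_bool (y = v) = load \<mu> X y + of_bool (y = w)"
      using reroute[OF h(1) assms(1) valid'] by blast
    have vw: "v \<noteq> w"
      using h ab[of v] ab[of w] by auto
    have v: "load \<mu>' X v + 1 = load \<mu> X v" and w: "load \<mu>' X w = load \<mu> X w + 1"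
      and others: "y \<noteq> v \<Longrightarrow> y \<noteq> w \<Longrightarrow> load \<mu>' X y = load \<mu> X y" for y
      using \<mu>'(2)[of v] \<mu>'(2)[of w] \<mu>'(2)[of y] vw by auto
    have le: "(a y - load \<mu>' X y) + (load \<mu>' X y - b y) \<le> (a y - load \<mu> X y) + (load \<mu> X y - b y)"
      for y
      using others[of y] v w h by (cases "y = v"; cases "y = w") auto
    have "viol \<mu>' < viol \<mu>"
      unfolding viol_def
    proof (rule sum_strict_mono_ex1)
      from h(6) show "\<exists>y\<in>V. (a y - load \<mu>' X y) + (load \<mu>' X y - b y) <
          (a y - load \<mu> X y) + (load \<mu> X y - b y)"
      proof
        assume "b v < load \<mu> X v"
        then show ?thesis using h v by (intro bexI[of _ v]) auto
      next
        assume "load \<mu> X w < a w"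
        then show ?thesis using h w ab[of w] by (intro bexI[of _ w]) auto
      qed
    qed (use le assms(2) in auto)
    then show False
      using least[of \<mu>'] \<mu>'(1) by (simp add: valid_def)
  qed
  have move: "can_move A X \<mu> (\<mu> x) w" if "x \<in> X" "w \<in> A x" for x w
    using that by (auto simp: can_move_def)
  have reach_V: "w \<in> V" if "?R v w" "v \<in> V" for v w
    using that by (induction rule: rtranclp_induct) (use AV in \<open>auto simp: can_move_def\<close>)
  have "load \<mu> X v \<le> b v" if v: "v \<in> V" for v
  proof (rule ccontr)
    assume over: "\<not> load \<mu> X v \<le> b v"
    define R where "R = {w. ?R v w}"
    have RV: "R \<subseteq> V" and fin: "finite R"
      using reach_V v assms(2) by (auto simp: R_def intro: finite_subset)
    have "b w \<le> load \<mu> X w" if "w \<in> R" for w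
      using no_improvement[of v w] that over v RV ab[OF v] by (fastforce simp: R_def)
    then have "sum b R < (\<Sum>w\<in>R. load \<mu> X w)"
      using over fin by (intro sum_strict_mono_ex1) (auto simp: R_def)
    also have "\<dots> = card {x \<in> X. \<mu> x \<in> R}"
      by (rule sum_load[OF assms(1) fin])
    \<comment> \<open>\<open>R\<close> is closed under moves, so an element located in
      \<open>R\<close> has all its options in \<open>R\<close>.\<close>
    also have "\<dots> \<le> card {x \<in> X. A x \<subseteq> R}"
    proof (rule card_mono)
      show "{x \<in> X. \<mu> x \<in> R} \<subseteq> {x \<in> X. A x \<subseteq> R}"
        using move by (auto simp: R_def intro: rtranclp.rtrancl_into_rtrancl)
    qed (use assms(1) in simp)
    also have "\<dots> \<le> sum b R"
      by (rule upper[OF RV])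
    finally show False by simp
  qed
  moreover have "a v \<le> load \<mu> X v" if v: "v \<in> V" for v
  proof (rule ccontr)
    assume under: "\<not> a v \<le> load \<mu> X v"
    define R where "R = {w \<in> V. ?R w v}"
    have RV: "R \<subseteq> V" and fin: "finite R"
      using assms(2) by (auto simp: R_def)
    have "load \<mu> X w \<le> a w" if "w \<in> R" for w
      using no_improvement[of w v] that under v RV ab[OF v] by (fastforce simp: R_def)
    then have "(\<Sum>w\<in>R. load \<mu> X w) < sum a R"
      using under fin v by (intro sum_strict_mono_ex1) (auto simp: R_def)
    moreover have "(\<Sum>w\<in>R. load \<mu> X w) = card {x \<in> X. \<mu> x \<in> R}"
      by (rule sum_load[OF assms(1) fin])
    \<comment> \<open>\<open>R\<close> is closed under predecessors, so an element with an option in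
      \<open>R\<close> is located in \<open>R\<close>.\<close>
    moreover have "card {x \<in> X. A x \<inter> R \<noteq> {}} \<le> card {x \<in> X. \<mu> x \<in> R}"
    proof (rule card_mono)
      show "{x \<in> X. A x \<inter> R \<noteq> {}} \<subseteq> {x \<in> X. \<mu> x \<in> R}"
      proof safe
        fix x w
        assume "x \<in> X" "w \<in> A x" "w \<in> R"
        then show "\<mu> x \<in> R"
          using move[of x w] valid' AV
            converse_rtranclp_into_rtranclp[of "can_move A X \<mu>" "\<mu> x" w v]
          by (auto simp: R_def)
      qed
    qed (use assms(1) in simp)
    ultimately show False
      using lower[OF RV] by simp
  qed
  ultimately show thesis
    using that valid' by blast
qed


section \<open>Fair matchings as solutions of a system of inequalities\<close>

text \<open>The minimum over the colors serves as m. In this form the colors no longer interact once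
  m is fixed.\<close>

lemma fair_set_iff:
  assumes "finite C" "C \<noteq> {}"
  shows "fair_set C col l P \<longleftrightarrow>
    (\<exists>m. \<forall>c\<in>C. m \<le> card (color_class col P c) \<and> card (color_class col P c) \<le> m + l)"
    (is "_ \<longleftrightarrow> (\<exists>m. \<forall>c\<in>C. m \<le> ?f c \<and> ?f c \<le> m + l)")
proof
  assume "fair_set C col l P"
  then have "Max (?f ` C) \<le> Min (?f ` C) + l"
    by (simp add: fair_set_def MaxMin_def)
  moreover have "Min (?f ` C) \<le> ?f c" "?f c \<le> Max (?f ` C)" if "c \<in> C" for c
    using that assms by simp_all
  ultimately show "\<exists>m. \<forall>c\<in>C. m \<le> ?f c \<and> ?f c \<le> m + l"
    by (meson order_trans)
next
  assume "\<exists>m. \<forall>c\<in>C. m \<le> ?f c \<and> ?f c \<le> m + l"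
  then obtain m where m: "\<forall>c\<in>C. m \<le> ?f c \<and> ?f c \<le> m + l" ..
  have "Max (?f ` C) \<in> ?f ` C" "Min (?f ` C) \<in> ?f ` C"
    using assms by simp_all
  then have "Max (?f ` C) \<le> m + l" "m \<le> Min (?f ` C)"
    using m by auto
  then show "fair_set C col l P"
    by (simp add: fair_set_def MaxMin_def)
qed

locale fair_problem =
  fixes I :: "('v, 'c) fair_instance"
  assumes valid: "valid_instance I"
begin

definition nbrs :: "'v \<Rightarrow> 'v set" where
  "nbrs u = {v \<in> rights I. {u, v} \<in> edges I}"

definition lefts_of :: "'c \<Rightarrow> 'v set" where
  "lefts_of c = color_class (coloring I) (lefts I) c"

lemma finite_instance:
  "finite (lefts I)" "finite (rights I)" "lefts I \<inter> rights I = {}"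
  "edges I \<subseteq> {{u, v} | u v. u \<in> lefts I \<and> v \<in> rights I}"
  "finite (colors I)" "colors I \<noteq> {}" "coloring I ` lefts I \<subseteq> colors I"
  using valid by (auto simp: valid_instance_def bipartite_graph_def)

lemma finite_lefts_of: "finite (lefts_of c)"
  using finite_instance(1) by (simp add: lefts_of_def color_class_def)

lemma nbrs_subset: "nbrs u \<subseteq> rights I"
  by (auto simp: nbrs_def)

definition fair_assignment :: "('v \<Rightarrow> 'v) \<Rightarrow> bool" where
  "fair_assignment \<mu> \<longleftrightarrow> (\<forall>u\<in>lefts I. \<mu> u \<in> nbrs u) \<and>
     (\<forall>v\<in>rights I. \<exists>m. \<forall>c\<in>colors I.
        m \<le> load \<mu> (lefts_of c) v \<and> load \<mu> (lefts_of c) v \<le> m + bound I) \<and>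
     (\<forall>v\<in>rights I. \<exists>u\<in>lefts I. \<mu> u = v)"

lemma fair_assignment_iff:
  assumes "\<forall>v\<in>rights I. partners M v = {u \<in> lefts I. \<mu> u = v}" "\<forall>u\<in>lefts I. \<mu> u \<in> nbrs u"
  shows "fair_assignment \<mu> \<longleftrightarrow>
    fair_matching (rights I) (colors I) (coloring I) (bound I) M \<and>
    (\<forall>v\<in>rights I. partners M v \<noteq> {})"
proof -
  have "card (color_class (coloring I) (partners M v) c) = load \<mu> (lefts_of c) v"
    if "v \<in> rights I" for v c
    unfolding load_def lefts_of_def color_class_def
    by (rule arg_cong[of _ _ card]) (use that assms(1) in auto)
  then show ?thesis
    using assms by (auto simp: fair_assignment_def fair_matching_def fair_set_iff finite_instance)
qed

lemma problem_iff_fair_assignment: "MaxMin_Fair_Matching_nonempty I \<longleftrightarrow> (\<exists>\<mu>. fair_assignment \<mu>)"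
proof
  assume "MaxMin_Fair_Matching_nonempty I"
  then obtain M where M: "M \<subseteq> edges I" "\<And>u. u \<in> lefts I \<Longrightarrow> card (partners M u) = 1"
    "fair_matching (rights I) (colors I) (coloring I) (bound I) M"
    "\<forall>v\<in>rights I. partners M v \<noteq> {}"
    by (auto simp: MaxMin_Fair_Matching_nonempty_def many_to_one_matching_def left_perfect_def)
  have "\<forall>u\<in>lefts I. \<exists>v. partners M u = {v}"
    using M(2) card_1_singletonE by metis
  then obtain \<mu> where \<mu>: "\<forall>u\<in>lefts I. partners M u = {\<mu> u}"
    by metis
  have edge: "{u, v} \<in> M \<longleftrightarrow> \<mu> u = v" if "u \<in> lefts I" for u v
  proof -
    have "v \<in> partners M u \<longleftrightarrow> v = \<mu> u"
      using \<mu> that by simp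
    then show ?thesis
      by (auto simp: partners_def)
  qed
  have ends: "\<exists>u v. e = {u, v} \<and> u \<in> lefts I \<and> v \<in> rights I" if "e \<in> M" for e
    using that M(1) finite_instance(4) by blast
  have "\<forall>u\<in>lefts I. \<mu> u \<in> nbrs u"
  proof
    fix u
    assume u: "u \<in> lefts I"
    then have "{u, \<mu> u} \<in> M"
      using edge by blast
    moreover from ends[OF this] obtain u' v where "{u, \<mu> u} = {u', v}" "u' \<in> lefts I" "v \<in> rights I"
      by blast
    \<comment> \<open>Edges are unordered pairs; disjointness of the sides identifies
      \<open>u\<close> as the left endpoint.\<close>
    ultimately show "\<mu> u \<in> nbrs u"
      using u M(1) finite_instance(3) by (auto simp: nbrs_def doubleton_eq_iff)
  qed
  moreover have "partners M v = {u \<in> lefts I. \<mu> u = v}" if v: "v \<in> rights I" for v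
  proof -
    have "u \<in> lefts I" if "{v, u} \<in> M" for u
      using ends[OF that] v finite_instance(3) by (auto simp: doubleton_eq_iff)
    then show ?thesis
      using edge by (auto simp: partners_def insert_commute)
  qed
  ultimately show "\<exists>\<mu>. fair_assignment \<mu>"
    using fair_assignment_iff[of M \<mu>] M(3,4) by blast
next
  assume "\<exists>\<mu>. fair_assignment \<mu>"
  then obtain \<mu> where \<mu>: "fair_assignment \<mu>" ..
  then have nbrs: "\<forall>u\<in>lefts I. \<mu> u \<in> nbrs u"
    by (simp add: fair_assignment_def)
  define M where "M = (\<lambda>u. {u, \<mu> u}) ` lefts I"
  have sub: "M \<subseteq> edges I"
    using nbrs by (auto simp: M_def nbrs_def)
  have disj: "\<mu> u \<notin> lefts I" "\<mu> u \<in> rights I" if "u \<in> lefts I" for u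
    using that nbrs finite_instance(3) by (auto simp: nbrs_def)
  have lefts: "partners M u = {\<mu> u}" if "u \<in> lefts I" for u
    using that disj by (auto simp: partners_def M_def doubleton_eq_iff)
  have rights: "partners M v = {u \<in> lefts I. \<mu> u = v}" if "v \<in> rights I" for v
    using that nbrs finite_instance(3) by (auto simp: partners_def M_def nbrs_def doubleton_eq_iff)
  have "fair_matching (rights I) (colors I) (coloring I) (bound I) M"
    "\<forall>v\<in>rights I. partners M v \<noteq> {}"
    using fair_assignment_iff[of M \<mu>] rights nbrs \<mu> by blast+
  then show "MaxMin_Fair_Matching_nonempty I"
    using sub lefts
    unfolding MaxMin_Fair_Matching_nonempty_def many_to_one_matching_def left_perfect_def
    by (intro exI[of _ M]) simp
qed

text \<open>\<open>m v\<close> is a lower bound for the loads of \<open>v\<close> in all colors, and \<open>T c\<close> is a set of right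
  vertices at which color \<open>c\<close> exceeds this lower bound; the latter guarantees nonemptiness where \<open>m\<close> is 0.\<close>

definition solution :: "('v \<Rightarrow> nat) \<Rightarrow> ('c \<Rightarrow> 'v set) \<Rightarrow> bool" where
  "solution m T \<longleftrightarrow>
     (\<forall>c\<in>colors I. T c \<subseteq> rights I \<and> (bound I = 0 \<longrightarrow> T c = {}) \<and>
        (\<forall>S\<subseteq>rights I.
           sum m S + card (S \<inter> T c) \<le> card {u \<in> lefts_of c. nbrs u \<inter> S \<noteq> {}} \<and>
           card {u \<in> lefts_of c. nbrs u \<subseteq> S} \<le> sum m S + bound I * card S)) \<and>
     (\<forall>v\<in>rights I. m v = 0 \<longrightarrow> (\<exists>c\<in>colors I. v \<in> T c))"

lemma sum_add_of_bool:
  "finite S \<Longrightarrow> (\<Sum>v\<in>S. m v + of_bool (v \<in> T)) = sum m S + card (S \<inter> T)"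
  by (simp add: sum.distrib Int_def)

text \<open>The easy half of the Hall-type condition: both inequalities follow by counting the left
  vertices of one color that are assigned into S.\<close>

lemma solution_if_fair_assignment:
  assumes "fair_assignment \<mu>"
  shows "\<exists>m T. solution m T"
proof -
  obtain m where m: "\<And>v c. v \<in> rights I \<Longrightarrow> c \<in> colors I \<Longrightarrow>
      m v \<le> load \<mu> (lefts_of c) v \<and> load \<mu> (lefts_of c) v \<le> m v + bound I"
    using assms unfolding fair_assignment_def by metis
  have nbrs: "\<And>u c. u \<in> lefts_of c \<Longrightarrow> \<mu> u \<in> nbrs u"
    using assms by (auto simp: fair_assignment_def lefts_of_def color_class_def)
  \<comment> \<open>Where m vanishes, a nonzero load exceeds it. For l = 0 this cannot occur, and
    the color of any left vertex assigned to such a \<open>v\<close> covers it.\<close>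
  define T where "T c = {v \<in> rights I. m v = 0 \<and> load \<mu> (lefts_of c) v \<noteq> 0}" for c
  have "sum m S + card (S \<inter> T c) \<le> card {u \<in> lefts_of c. nbrs u \<inter> S \<noteq> {}}"
    "card {u \<in> lefts_of c. nbrs u \<subseteq> S} \<le> sum m S + bound I * card S"
    if "S \<subseteq> rights I" "c \<in> colors I" for S c
  proof -
    have fin: "finite S"
      using that(1) finite_instance(2) finite_subset by blast
    note load_eq = sum_load[OF finite_lefts_of fin, of \<mu> c]
    have "sum m S + card (S \<inter> T c) = (\<Sum>v\<in>S. m v + of_bool (v \<in> T c))"
      by (rule sum_add_of_bool[OF fin, symmetric])
    also have "\<dots> \<le> (\<Sum>v\<in>S. load \<mu> (lefts_of c) v)"
      using that m by (intro sum_mono) (force simp: T_def)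
    also have "\<dots> \<le> card {u \<in> lefts_of c. nbrs u \<inter> S \<noteq> {}}"
      unfolding load_eq by (rule card_mono) (use nbrs finite_lefts_of in auto)
    finally show "sum m S + card (S \<inter> T c) \<le> card {u \<in> lefts_of c. nbrs u \<inter> S \<noteq> {}}" .
    have "card {u \<in> lefts_of c. nbrs u \<subseteq> S} \<le> card {u \<in> lefts_of c. \<mu> u \<in> S}"
      by (rule card_mono) (use nbrs finite_lefts_of in auto)
    also have "\<dots> = (\<Sum>v\<in>S. load \<mu> (lefts_of c) v)"
      by (rule load_eq[symmetric])
    also have "\<dots> \<le> (\<Sum>v\<in>S. m v + bound I)"
      using that m by (intro sum_mono) auto
    also have "\<dots> = sum m S + bound I * card S"
      by (simp add: sum.distrib)
    finally show "card {u \<in> lefts_of c. nbrs u \<subseteq> S} \<le> sum m S + bound I * card S" .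
  qed
  moreover have "T c = {}" if "bound I = 0" "c \<in> colors I" for c
    using that m[of _ c] by (fastforce simp: T_def)
  moreover have "\<exists>c\<in>colors I. v \<in> T c" if v: "v \<in> rights I" "m v = 0" for v
  proof -
    obtain u where u: "u \<in> lefts I" "\<mu> u = v"
      using assms v(1) unfolding fair_assignment_def by blast
    then have "u \<in> {u' \<in> lefts_of (coloring I u). \<mu> u' = v}"
      by (simp add: lefts_of_def color_class_def)
    then have "load \<mu> (lefts_of (coloring I u)) v \<noteq> 0"
      using finite_lefts_of by (auto simp: load_def card_eq_0_iff)
    then show ?thesis
      using v u finite_instance(7) by (auto simp: T_def)
  qed
  ultimately have "solution m T"
    unfolding solution_def by (auto simp: T_def)
  then show ?thesis
    by blast
qed

text \<open>Each color class is assigned separately by \<open>assignment_with_bounded_loads\<close>,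
  and the assignments are glued along the coloring.\<close>

lemma fair_assignment_if_solution:
  assumes "solution m T"
  shows "\<exists>\<mu>. fair_assignment \<mu>"
proof -
  have "\<exists>\<mu>. (\<forall>u\<in>lefts_of c. \<mu> u \<in> nbrs u) \<and> (\<forall>v\<in>rights I.
      m v + of_bool (v \<in> T c) \<le> load \<mu> (lefts_of c) v \<and> load \<mu> (lefts_of c) v \<le> m v + bound I)"
    if c: "c \<in> colors I" for c
  proof -
    note sol = assms[unfolded solution_def, THEN conjunct1, rule_format, OF c]
    \<comment> \<open>The lower bound at a vertex of \<open>T c\<close> is m(v) + 1; it does not
      exceed m(v) + l, because \<open>T c\<close> is empty for l = 0.\<close>
    show ?thesis
    proof (rule assignment_with_bounded_loads[of "lefts_of c" "rights I" nbrs
          "\<lambda>v. m v + of_bool (v \<in> T c)" "\<lambda>v. m v + bound I"])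
      fix S
      assume S: "S \<subseteq> rights I"
      then have fin: "finite S"
        using finite_instance(2) finite_subset by blast
      show "(\<Sum>v\<in>S. m v + of_bool (v \<in> T c)) \<le> card {x \<in> lefts_of c. nbrs x \<inter> S \<noteq> {}}"
        unfolding sum_add_of_bool[OF fin] using sol S by blast
      show "card {x \<in> lefts_of c. nbrs x \<subseteq> S} \<le> (\<Sum>v\<in>S. m v + bound I)"
        using sol S by (simp add: sum.distrib mult.commute)
    next
      fix \<mu>
      assume "\<forall>u\<in>lefts_of c. \<mu> u \<in> nbrs u" "\<forall>v\<in>rights I.
        m v + of_bool (v \<in> T c) \<le> load \<mu> (lefts_of c) v \<and> load \<mu> (lefts_of c) v \<le> m v + bound I"
      then show ?thesis
        by blast
    qed (use sol finite_lefts_of finite_instance(2) nbrs_subset in \<open>auto\<close>)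
  qed
  then obtain \<mu> where \<mu>: "\<And>c. c \<in> colors I \<Longrightarrow> (\<forall>u\<in>lefts_of c. \<mu> c u \<in> nbrs u) \<and>
      (\<forall>v\<in>rights I. m v + of_bool (v \<in> T c) \<le> load (\<mu> c) (lefts_of c) v \<and>
         load (\<mu> c) (lefts_of c) v \<le> m v + bound I)"
    by metis
  define \<nu> where "\<nu> u = \<mu> (coloring I u) u" for u
  have load: "load \<nu> (lefts_of c) v = load (\<mu> c) (lefts_of c) v" for c v
    unfolding load_def \<nu>_def lefts_of_def color_class_def
    by (rule arg_cong[of _ _ card]) auto
  have "\<nu> u \<in> nbrs u" if "u \<in> lefts I" for u
    using \<mu>[of "coloring I u"] that finite_instance(7)
    by (auto simp: \<nu>_def lefts_of_def color_class_def)
  moreover have "\<exists>u\<in>lefts I. \<nu> u = v" if v: "v \<in> rights I" for v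
  proof -
    \<comment> \<open>If m(v) > 0, any color has positive load at \<open>v\<close>; otherwise a
      color covering \<open>v\<close> does.\<close>
    obtain c where c: "c \<in> colors I" "m v + of_bool (v \<in> T c) \<noteq> 0"
    proof (cases "m v = 0")
      case True
      then show ?thesis using that assms v by (auto simp: solution_def)
    next
      case False
      then show ?thesis using that finite_instance(6) by auto
    qed
    then have "load \<nu> (lefts_of c) v \<noteq> 0"
      using \<mu>[OF c(1)] v unfolding load by fastforce
    then have "{u \<in> lefts_of c. \<nu> u = v} \<noteq> {}"
      unfolding load_def by (metis card.empty)
    then show ?thesis
      by (auto simp: lefts_of_def color_class_def)
  qed
  moreover have "\<exists>m. \<forall>c\<in>colors I. m \<le> load \<nu> (lefts_of c) v \<and> load \<nu> (lefts_of c) v \<le> m + bound I"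
    if "v \<in> rights I" for v
    using \<mu> that unfolding load by (intro exI[of _ "m v"]) fastforce
  ultimately have "fair_assignment \<nu>"
    unfolding fair_assignment_def by blast
  then show ?thesis
    by blast
qed

theorem problem_iff_solution: "MaxMin_Fair_Matching_nonempty I \<longleftrightarrow> (\<exists>m T. solution m T)"
  using problem_iff_fair_assignment solution_if_fair_assignment fair_assignment_if_solution by blast

end


section \<open>Correctness of the algorithm\<close>

context fair_input
begin

text \<open>Acceptance along a single sequence of guesses. Correctness is argued on this
  nondeterministic view, free of state lists and duplicate removal.\<close>

primrec acc :: "nat option list \<Rightarrow> nat list \<times> (nat list \<times> nat \<times> nat) list \<Rightarrow> bool" where
  "acc [] st \<longleftrightarrow> good st"
| "acc (op # ps) st \<longleftrightarrow> (\<exists>T\<in>set (choices op). acc ps (step op T st))"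

lemma iterate_good_iff_acc: "(\<exists>st\<in>set (iterate ps sts). good st) \<longleftrightarrow> (\<exists>st\<in>set sts. acc ps st)"
proof (induction ps arbitrary: sts)
  case Nil
  show ?case by (simp add: iterate_def)
next
  case (Cons op ps)
  have "(\<exists>st\<in>set (iterate (op # ps) sts). good st) \<longleftrightarrow> (\<exists>st\<in>set (expands op sts []). acc ps st)"
    using Cons[of "expands op sts []"] by (simp add: iterate_def)
  also have "\<dots> \<longleftrightarrow> (\<exists>st\<in>set sts. acc (op # ps) st)"
    unfolding set_expands list.set(1) Un_empty_right acc.simps by blast
  finally show ?case .
qed

section \<open>Meaning of the transitions for integer points\<close>

definition sat :: "(nat \<Rightarrow> nat) \<Rightarrow> (nat list \<times> nat \<times> nat) list \<Rightarrow> bool" where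
  "sat m vec \<longleftrightarrow> (\<forall>(S, F, L)\<in>set vec. sum m (set S) < F \<and> L \<le> sum m (set S))"

definition color_sat :: "(nat \<Rightarrow> nat) \<Rightarrow> nat \<Rightarrow> nat list \<Rightarrow> bool" where
  "color_sat m c T \<longleftrightarrow> (\<forall>S\<in>set (subseqs vs).
     sum m (set S) < count_touching ucs es c S + 1 - isect S T \<and> lower c S \<le> sum m (set S))"

lemma sat_cong:
  assumes "\<And>S. S \<in> fst ` set vec \<Longrightarrow> sum m (set S) = sum m' (set S)"
  shows "sat m vec = sat m' vec"
proof -
  have "sum m (set (fst e)) = sum m' (set (fst e))" if "e \<in> set vec" for e
    using that assms by simp
  then show ?thesis
    by (simp add: sat_def split_beta)
qed

lemma sat_step_Some:
  assumes "map fst vec = subseqs vs"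
  shows "sat m (map (step_entry (Some c) T) vec) \<longleftrightarrow> sat m vec \<and> color_sat m c T"
proof -
  have "set (subseqs vs) = fst ` set vec"
    using assms by (metis set_map)
  then have "color_sat m c T \<longleftrightarrow> (\<forall>(S, F, L)\<in>set vec.
      sum m (set S) < count_touching ucs es c S + 1 - isect S T \<and> lower c S \<le> sum m (set S))"
    by (simp add: color_sat_def split_beta del: in_set_subseqs)
  then show ?thesis
    by (auto simp: sat_def step_entry_def)
qed

lemma isect_eq_card: "distinct S \<Longrightarrow> isect S T = card (set S \<inter> set T)"
  unfolding isect_def by (subst distinct_card[symmetric]) (auto simp: Int_def)

text \<open>With s = m(S) and i = |S \<inter> T|: 2s + i < F iff s < (F + 1 - i) div 2, and L \<le>
  2s + i iff (L + 1 - i) div 2 \<le> s. Both equivalences survive truncated subtraction.\<close>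

lemma sat_step_None:
  assumes "\<forall>S\<in>fst ` set vec. distinct S"
  shows "sat m (map (step_entry None T) vec) \<longleftrightarrow> sat (\<lambda>v. 2 * m v + of_bool (v \<in> set T)) vec"
proof -
  have "(sum m (set S) < (F + 1 - isect S T) div 2 \<and> (L + 1 - isect S T) div 2 \<le> sum m (set S)) \<longleftrightarrow>
    ((\<Sum>v\<in>set S. 2 * m v + of_bool (v \<in> set T)) < F \<and>
      L \<le> (\<Sum>v\<in>set S. 2 * m v + of_bool (v \<in> set T)))" if "distinct S" for S F L
  proof -
    have "(\<Sum>v\<in>set S. 2 * m v + of_bool (v \<in> set T)) = 2 * sum m (set S) + isect S T"
      by (simp add: sum.distrib sum_distrib_left isect_eq_card[OF that] Int_def)
    then show ?thesis
      by auto
  qed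
  then show ?thesis
    using assms by (simp add: sat_def step_entry_def split_beta)
qed

lemma map_fst_step: "map fst (map (step_entry op T) vec) = map fst vec"
  by (auto simp: step_entry_def)

text \<open>Induction on the number of binary digits: each guess fixes the least significant digit
  of all values m(v) at once, and with no digits left m = 0 is the only candidate. Halvings never
  change \<open>Z\<close>, so it has to be empty already.\<close>

lemma acc_halving:
  assumes "distinct vs" "map fst vec = subseqs vs"
  shows "acc (replicate j None) (Z, vec) \<longleftrightarrow> Z = [] \<and> (\<exists>m. (\<forall>v\<in>set vs. m v < 2 ^ j) \<and> sat m vec)"
  using assms(2)
proof (induction j arbitrary: vec)
  case 0
  have sub: "set S \<subseteq> set vs" if "(S, F, L) \<in> set vec" for S F L
  proof -
    have "S \<in> set (map fst vec)"
      using that by force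
    then show ?thesis
      unfolding 0 by (auto dest: list_emb_set)
  qed
  have "good_vec vec \<longleftrightarrow> sat m vec" if m: "\<forall>v\<in>set vs. m v = 0" for m
  proof -
    have "sum m (set S) = 0" if "(S, F, L) \<in> set vec" for S F L
      using sub[OF that] m by auto
    then show ?thesis
      unfolding good_vec_def sat_def by (intro ball_cong refl) auto
  qed
  then show ?case
    by (auto simp: good_def)
next
  case (Suc j)
  have fst_vec: "fst ` set vec = set (subseqs vs)"
    using Suc.prems by (metis set_map)
  have dist: "\<forall>S\<in>fst ` set vec. distinct S"
    unfolding fst_vec using assms(1) subseqs_distinctD by blast
  have IH: "acc (replicate j None) (Z, map (step_entry None T) vec) \<longleftrightarrow>
      Z = [] \<and> (\<exists>m. (\<forall>v\<in>set vs. m v < 2 ^ j) \<and>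
        sat (\<lambda>v. 2 * m v + of_bool (v \<in> set T)) vec)" for T
    unfolding sat_step_None[OF dist, symmetric]
    by (rule Suc.IH) (use Suc.prems in \<open>simp only: map_fst_step\<close>)
  have "acc (replicate (Suc j) None) (Z, vec) \<longleftrightarrow>
      Z = [] \<and> (\<exists>T\<in>set (subseqs vs). \<exists>m. (\<forall>v\<in>set vs. m v < 2 ^ j) \<and>
        sat (\<lambda>v. 2 * m v + of_bool (v \<in> set T)) vec)"
    by (simp del: in_set_subseqs add: step_def choices_def IH)
  also have "(\<exists>T\<in>set (subseqs vs). \<exists>m. (\<forall>v\<in>set vs. m v < 2 ^ j) \<and>
        sat (\<lambda>v. 2 * m v + of_bool (v \<in> set T)) vec) \<longleftrightarrow>
      (\<exists>m. (\<forall>v\<in>set vs. m v < 2 ^ Suc j) \<and> sat m vec)" (is "?L \<longleftrightarrow> ?R")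
  proof
    assume ?L
    then obtain T m where "\<forall>v\<in>set vs. m v < 2 ^ j" "sat (\<lambda>v. 2 * m v + of_bool (v \<in> set T)) vec"
      by blast
    then show ?R
      by (intro exI[of _ "\<lambda>v. 2 * m v + of_bool (v \<in> set T)"]) (auto simp: of_bool_def)
  next
    assume ?R
    then obtain m where m: "\<forall>v\<in>set vs. m v < 2 ^ Suc j" "sat m vec"
      by blast
    \<comment> \<open>The right guess is the set of odd values, so that m = 2 (m div 2) + 1 on T and
      2 (m div 2) elsewhere.\<close>
    define T where "T = filter (\<lambda>v. odd (m v)) vs"
    have "sat (\<lambda>v. 2 * (m v div 2) + of_bool (v \<in> set T)) vec \<longleftrightarrow> sat m vec"
    proof (rule sat_cong, rule sum.cong)
      fix S v
      assume "S \<in> fst ` set vec" "v \<in> set S"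
      then have "v \<in> set vs"
        unfolding fst_vec by (auto dest: list_emb_set)
      then show "2 * (m v div 2) + of_bool (v \<in> set T) = m v"
        by (cases "even (m v)") (auto simp: T_def)
    qed simp
    then show ?L
      using m by (intro bexI[of _ T] exI[of _ "\<lambda>v. m v div 2"]) (auto simp: T_def)
  qed
  finally show ?case .
qed

text \<open>All colors constrain one common m, whose digits are guessed only after the last color;
  \<open>sat_step_Some\<close> splits off the constraints of each color. The function \<tau>
  collects the guesses.\<close>

lemma acc_colors:
  assumes "distinct vs" "map fst vec = subseqs vs" "distinct ds"
  shows "acc (map Some ds @ replicate j None) (Z, vec) \<longleftrightarrow>
    (\<exists>m \<tau>. (\<forall>v\<in>set vs. m v < 2 ^ j) \<and> sat m vec \<and>
      (\<forall>c\<in>set ds. \<tau> c \<in> set (choices (Some c)) \<and> color_sat m c (\<tau> c)) \<and>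
      set Z \<subseteq> (\<Union>c\<in>set ds. set (\<tau> c)))"
  using assms(2,3)
proof (induction ds arbitrary: Z vec)
  case Nil
  then show ?case
    using acc_halving[OF assms(1) Nil(1)] by auto
next
  case (Cons c ds)
  have IH: "acc (map Some ds @ replicate j None) (Z', map (step_entry (Some c) T) vec) \<longleftrightarrow>
    (\<exists>m \<tau>. (\<forall>v\<in>set vs. m v < 2 ^ j) \<and> (sat m vec \<and> color_sat m c T) \<and>
      (\<forall>c\<in>set ds. \<tau> c \<in> set (choices (Some c)) \<and> color_sat m c (\<tau> c)) \<and>
      set Z' \<subseteq> (\<Union>c\<in>set ds. set (\<tau> c)))" for Z' T
    unfolding sat_step_Some[OF Cons.prems(1), symmetric]
    by (rule Cons.IH) (use Cons.prems in \<open>simp_all only: map_fst_step distinct.simps\<close>)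
  have "acc (map Some (c # ds) @ replicate j None) (Z, vec) \<longleftrightarrow>
    (\<exists>T\<in>set (choices (Some c)). \<exists>m \<tau>. (\<forall>v\<in>set vs. m v < 2 ^ j) \<and> (sat m vec \<and> color_sat m c T) \<and>
      (\<forall>c\<in>set ds. \<tau> c \<in> set (choices (Some c)) \<and> color_sat m c (\<tau> c)) \<and>
      set (filter (\<lambda>v. v \<notin> set T) Z) \<subseteq> (\<Union>c\<in>set ds. set (\<tau> c)))"
    by (simp only: list.map append_Cons acc.simps step_def prod.case option.distinct if_False IH)
  also have "\<dots> \<longleftrightarrow> (\<exists>m \<tau>. (\<forall>v\<in>set vs. m v < 2 ^ j) \<and> sat m vec \<and>
      (\<forall>d\<in>set (c # ds). \<tau> d \<in> set (choices (Some d)) \<and> color_sat m d (\<tau> d)) \<and>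
      set Z \<subseteq> (\<Union>d\<in>set (c # ds). set (\<tau> d)))" (is "?L \<longleftrightarrow> ?R")
  proof
    assume ?L
    then obtain T m \<tau> where *: "T \<in> set (choices (Some c))" "\<forall>v\<in>set vs. m v < 2 ^ j"
      "sat m vec" "color_sat m c T"
      "\<forall>d\<in>set ds. \<tau> d \<in> set (choices (Some d)) \<and> color_sat m d (\<tau> d)"
      "set (filter (\<lambda>v. v \<notin> set T) Z) \<subseteq> (\<Union>d\<in>set ds. set (\<tau> d))"
      by blast
    \<comment> \<open>Colors are listed without repetition, so recording the guess for
      \<open>c\<close> overwrites no other.\<close>
    have eq: "(\<tau>(c := T)) d = \<tau> d" if "d \<in> set ds" for d
      using that Cons.prems(2) by auto
    have "set Z \<subseteq> (\<Union>d\<in>set (c # ds). set ((\<tau>(c := T)) d))"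
    proof
      fix v
      assume "v \<in> set Z"
      then have "v \<in> set T \<or> (\<exists>d\<in>set ds. v \<in> set (\<tau> d))"
        using *(6) by auto
      then show "v \<in> (\<Union>d\<in>set (c # ds). set ((\<tau>(c := T)) d))"
        using eq by auto
    qed
    then show ?R
      using * eq by (intro exI[of _ m] exI[of _ "\<tau>(c := T)"]) auto
  next
    assume ?R
    then obtain m \<tau> where *: "\<forall>v\<in>set vs. m v < 2 ^ j" "sat m vec"
      "\<forall>d\<in>set (c # ds). \<tau> d \<in> set (choices (Some d)) \<and> color_sat m d (\<tau> d)"
      "set Z \<subseteq> (\<Union>d\<in>set (c # ds). set (\<tau> d))"
      by blast
    have "set (filter (\<lambda>v. v \<notin> set (\<tau> c)) Z) \<subseteq> (\<Union>d\<in>set ds. set (\<tau> d))"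
      using *(4) by auto
    then show ?L
      using * by (intro bexI[of _ "\<tau> c"] exI[of _ m] exI[of _ \<tau>]) auto
  qed
  finally show ?case .
qed

lemma accepts_iff:
  assumes "distinct vs" "distinct cs"
  shows "accepts \<longleftrightarrow> (\<exists>Z\<in>set (subseqs vs). \<exists>m \<tau>. (\<forall>v\<in>set vs. m v < 2 ^ n) \<and>
      (\<forall>S\<in>set (subseqs vs). sum m (set S) < n + 1 \<and> card (set S - set Z) \<le> sum m (set S)) \<and>
      (\<forall>c\<in>set cs. \<tau> c \<in> set (choices (Some c)) \<and> color_sat m c (\<tau> c)) \<and>
      set Z \<subseteq> (\<Union>c\<in>set cs. set (\<tau> c)))"
proof -
  have "length (filter (\<lambda>v. v \<notin> set Z) S) = card (set S - set Z)" if "S \<in> set (subseqs vs)" for S Z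
    using subseqs_distinctD[OF that assms(1)]
    by (subst distinct_card[symmetric]) (auto intro: arg_cong[of _ _ card])
  then have sat: "sat m (init_vec Z) \<longleftrightarrow>
      (\<forall>S\<in>set (subseqs vs). sum m (set S) < n + 1 \<and> card (set S - set Z) \<le> sum m (set S))" for m Z
    unfolding sat_def init_vec_def by (auto simp del: in_set_subseqs)
  have "map fst (init_vec Z) = subseqs vs" for Z
    by (simp add: init_vec_def comp_def)
  then show ?thesis
    unfolding accepts_def iterate_good_iff_acc
    by (simp del: in_set_subseqs add: inits_def ops_def acc_colors[OF assms(1) _ assms(2)] sat)
qed

end


section \<open>From lists back to the instance\<close>

lemma all_subseqs_iff: "(\<forall>S\<in>set (subseqs vs). P (set S)) \<longleftrightarrow> (\<forall>S\<subseteq>set vs. P S)"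
proof -
  have "(\<forall>S\<in>set (subseqs vs). P (set S)) \<longleftrightarrow> (\<forall>S\<in>set ` set (subseqs vs). P S)"
    by blast
  then show ?thesis
    unfolding subseqs_powset by blast
qed

lemma accepts_iff_problem:
  fixes I :: "(nat, nat) fair_instance"
  assumes "valid_instance I"
    and us: "distinct us" "set us = lefts I" and vs: "distinct vs" "set vs = rights I"
    and es: "set es = {(u, v). u \<in> lefts I \<and> v \<in> rights I \<and> {u, v} \<in> edges I}"
    and cs: "distinct cs" "set cs = colors I"
  shows "fair_input.accepts (map (\<lambda>u. (u, coloring I u)) us) vs es cs (bound I) \<longleftrightarrow>
    MaxMin_Fair_Matching_nonempty I"
proof -
  interpret P: fair_problem I
    by unfold_locales fact
  define ucs where "ucs = map (\<lambda>u. (u, coloring I u)) us"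
  interpret F: fair_input ucs vs es cs "bound I" .
  have n: "length ucs = card (lefts I)"
    using distinct_card[OF us(1)] us(2) by (simp add: ucs_def)
  have touching: "count_touching ucs es c S = card {u \<in> P.lefts_of c. P.nbrs u \<inter> set S \<noteq> {}}"
    if "set S \<subseteq> rights I" for c S
  proof -
    have "count_touching ucs es c S = length (filter (\<lambda>u. coloring I u = c \<and> touches es S u) us)"
      by (simp add: count_touching_def ucs_def filter_map comp_def)
    also have "\<dots> = card (set (filter (\<lambda>u. coloring I u = c \<and> touches es S u) us))"
      using us(1) by (intro distinct_card[symmetric]) simp
    also have "set (filter (\<lambda>u. coloring I u = c \<and> touches es S u) us) =
        {u \<in> P.lefts_of c. P.nbrs u \<inter> set S \<noteq> {}}"
      using that by (auto simp: us es touches_def P.lefts_of_def color_class_def P.nbrs_def)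
    finally show ?thesis .
  qed
  have avoiding: "count_avoiding ucs es c (filter (\<lambda>v. v \<notin> set S) vs) =
      card {u \<in> P.lefts_of c. P.nbrs u \<subseteq> set S}" for c S
  proof -
    let ?S = "filter (\<lambda>v. v \<notin> set S) vs"
    have "count_avoiding ucs es c ?S =
        length (filter (\<lambda>u. coloring I u = c \<and> \<not> touches es ?S u) us)"
      by (simp add: count_avoiding_def ucs_def filter_map comp_def)
    also have "\<dots> = card (set (filter (\<lambda>u. coloring I u = c \<and> \<not> touches es ?S u) us))"
      using us(1) by (intro distinct_card[symmetric]) simp
    also have "set (filter (\<lambda>u. coloring I u = c \<and> \<not> touches es ?S u) us) =
        {u \<in> P.lefts_of c. P.nbrs u \<subseteq> set S}"
      by (auto simp: us vs es touches_def P.lefts_of_def color_class_def P.nbrs_def)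
    finally show ?thesis .
  qed
  \<comment> \<open>The count is at most n. If l exceeds n and S is nonempty, both capped and
    uncapped subtraction yield 0; in all other cases they agree.\<close>
  have lower: "F.lower c S \<le> s \<longleftrightarrow>
      card {u \<in> P.lefts_of c. P.nbrs u \<subseteq> set S} \<le> s + bound I * card (set S)"
    if "distinct S" for c S s
  proof -
    have "card {u \<in> P.lefts_of c. P.nbrs u \<subseteq> set S} \<le> length ucs"
      unfolding n using P.finite_instance(1)
      by (intro card_mono) (auto simp: P.lefts_of_def color_class_def)
    then show ?thesis
      unfolding F.lower_def avoiding using distinct_card[OF that]
      by (cases "length ucs \<le> bound I"; cases "length S") (auto simp: min_def)
  qed
  have color_sat: "F.color_sat m c T \<longleftrightarrow> (\<forall>S\<subseteq>rights I.
      sum m S + card (S \<inter> set T) \<le> card {u \<in> P.lefts_of c. P.nbrs u \<inter> S \<noteq> {}} \<and>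
      card {u \<in> P.lefts_of c. P.nbrs u \<subseteq> S} \<le> sum m S + bound I * card S)" for m c T
  proof -
    have "set S \<subseteq> rights I \<and> distinct S" if "S \<in> set (subseqs vs)" for S
      using subseqs_distinctD[OF that vs(1)] that vs(2) by (auto dest: list_emb_set)
    then have "F.color_sat m c T \<longleftrightarrow> (\<forall>S\<in>set (subseqs vs).
      sum m (set S) + card (set S \<inter> set T) \<le> card {u \<in> P.lefts_of c. P.nbrs u \<inter> set S \<noteq> {}} \<and>
      card {u \<in> P.lefts_of c. P.nbrs u \<subseteq> set S} \<le> sum m (set S) + bound I * card (set S))"
      unfolding F.color_sat_def
      by (intro ball_cong refl) (auto simp: touching lower F.isect_eq_card less_diff_conv)
    then show ?thesis
      unfolding vs(2)[symmetric] by (subst (asm) all_subseqs_iff)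
  qed
  have choices: "T \<in> set (F.choices (Some c)) \<longleftrightarrow>
      T \<in> set (subseqs vs) \<and> (bound I = 0 \<longrightarrow> set T = {})" for T c
    unfolding F.choices_def by auto
  have "F.accepts \<longleftrightarrow> (\<exists>m T. P.solution m T)"
    unfolding F.accepts_iff[OF vs(1) cs(1)]
  proof
    assume "\<exists>Z\<in>set (subseqs vs). \<exists>m \<tau>. (\<forall>v\<in>set vs. m v < 2 ^ length ucs) \<and>
      (\<forall>S\<in>set (subseqs vs). sum m (set S) < length ucs + 1 \<and> card (set S - set Z) \<le> sum m (set S)) \<and>
      (\<forall>c\<in>set cs. \<tau> c \<in> set (F.choices (Some c)) \<and> F.color_sat m c (\<tau> c)) \<and>
      set Z \<subseteq> (\<Union>c\<in>set cs. set (\<tau> c))"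
    then obtain Z m \<tau> where
      Z: "\<forall>S\<in>set (subseqs vs). card (set S - set Z) \<le> sum m (set S)"
      and \<tau>: "\<forall>c\<in>colors I. \<tau> c \<in> set (F.choices (Some c)) \<and> F.color_sat m c (\<tau> c)"
      and ZT: "set Z \<subseteq> (\<Union>c\<in>colors I. set (\<tau> c))"
      unfolding cs(2) by blast
    from Z have Z': "card (S - set Z) \<le> sum m S" if "S \<subseteq> rights I" for S
      using that unfolding vs(2)[symmetric] all_subseqs_iff[of vs "\<lambda>S. card (S - set Z) \<le> sum m S"]
      by blast
    \<comment> \<open>Outside \<open>Z\<close> the initial constraint for the singleton would force
      m(v) \<ge> 1.\<close>
    have "v \<in> set Z" if "v \<in> rights I" "m v = 0" for v
    proof (rule ccontr)
      assume "v \<notin> set Z"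
      then have "{v} - set Z = {v}"
        by blast
      then show False
        using Z'[of "{v}"] that by simp
    qed
    then have "\<exists>c\<in>colors I. v \<in> set (\<tau> c)" if "v \<in> rights I" "m v = 0" for v
      using ZT that by blast
    then have "P.solution m (\<lambda>c. set (\<tau> c))"
      unfolding P.solution_def using \<tau>
      by (auto simp: choices color_sat vs(2)[symmetric] dest: list_emb_set)
    then show "\<exists>m T. P.solution m T"
      by blast
  next
    assume "\<exists>m T. P.solution m T"
    then obtain m T where sol: "P.solution m T"
      by blast
    then have sol_T: "T c \<subseteq> rights I" "bound I = 0 \<longrightarrow> T c = {}" if "c \<in> colors I" for c
      using that by (auto simp: P.solution_def)
    have "\<forall>c\<in>colors I. \<exists>L. L \<in> set (subseqs vs) \<and> set L = T c"
    proof
      fix c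
      assume "c \<in> colors I"
      then have "T c \<in> set ` set (subseqs vs)"
        unfolding subseqs_powset using sol_T vs(2) by simp
      then show "\<exists>L. L \<in> set (subseqs vs) \<and> set L = T c"
        by blast
    qed
    then obtain \<tau> where \<tau>: "\<And>c. c \<in> colors I \<Longrightarrow> \<tau> c \<in> set (subseqs vs) \<and> set (\<tau> c) = T c"
      by metis
    define Z where "Z = filter (\<lambda>v. m v = 0) vs"
    obtain c where c: "c \<in> colors I"
      using P.finite_instance(6) by blast
    \<comment> \<open>Any one color gives this bound, and there is a color because the color set is
      nonempty.\<close>
    have sum_le: "sum m S \<le> length ucs" if "S \<subseteq> rights I" for S
    proof -
      have "sum m S \<le> card {u \<in> P.lefts_of c. P.nbrs u \<inter> S \<noteq> {}}"
        using sol[unfolded P.solution_def, THEN conjunct1, rule_format, OF c] that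
        by (meson add_leD1)
      also have "\<dots> \<le> length ucs"
        unfolding n using P.finite_instance(1)
        by (intro card_mono) (auto simp: P.lefts_of_def color_class_def)
      finally show ?thesis .
    qed
    have "card (S - set Z) \<le> sum m S" if "S \<subseteq> rights I" for S
    proof -
      have fin: "finite S"
        using that P.finite_instance(2) finite_subset by blast
      have "card (S - set Z) = (\<Sum>v\<in>S - set Z. 1)"
        by simp
      also have "\<dots> \<le> sum m (S - set Z)"
        using that by (intro sum_mono) (auto simp: Z_def vs(2) Suc_le_eq)
      also have "\<dots> \<le> sum m S"
        using fin by (intro sum_mono2) auto
      finally show ?thesis .
    qed
    then have "\<forall>S\<in>set (subseqs vs). sum m (set S) < length ucs + 1 \<and>
        card (set S - set Z) \<le> sum m (set S)"
      using sum_le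
      by (subst all_subseqs_iff[of vs "\<lambda>S. sum m S < length ucs + 1 \<and> card (S - set Z) \<le> sum m S"])
        (simp add: vs(2) less_Suc_eq_le)
    moreover have "\<forall>v\<in>set vs. m v < 2 ^ length ucs"
    proof
      fix v
      assume "v \<in> set vs"
      then have "m v \<le> length ucs"
        using sum_le[of "{v}"] vs(2) by simp
      then show "m v < 2 ^ length ucs"
        using less_exp[of "length ucs"] by (rule le_less_trans)
    qed
    moreover have "\<forall>c\<in>set cs. \<tau> c \<in> set (F.choices (Some c)) \<and> F.color_sat m c (\<tau> c)"
    proof
      fix d
      assume "d \<in> set cs"
      then have d: "d \<in> colors I"
        using cs(2) by simp
      show "\<tau> d \<in> set (F.choices (Some d)) \<and> F.color_sat m d (\<tau> d)"
        using sol[unfolded P.solution_def, THEN conjunct1, rule_format, OF d] \<tau>[OF d]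
        unfolding choices color_sat by simp
    qed
    moreover have "set Z \<subseteq> (\<Union>c\<in>set cs. set (\<tau> c))"
      using sol \<tau> by (auto simp: Z_def vs(2) cs(2) P.solution_def)
    moreover have "Z \<in> set (subseqs vs)"
      by (simp add: Z_def)
    ultimately show "\<exists>Z\<in>set (subseqs vs). \<exists>m \<tau>. (\<forall>v\<in>set vs. m v < 2 ^ length ucs) \<and>
      (\<forall>S\<in>set (subseqs vs). sum m (set S) < length ucs + 1 \<and> card (set S - set Z) \<le> sum m (set S)) \<and>
      (\<forall>c\<in>set cs. \<tau> c \<in> set (F.choices (Some c)) \<and> F.color_sat m c (\<tau> c)) \<and>
      set Z \<subseteq> (\<Union>c\<in>set cs. set (\<tau> c))"
      by blast
  qed
  then show ?thesis
    unfolding ucs_def P.problem_iff_solution .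
qed

text \<open>Replacing k + 1 by 2^k gives the exponent k + 2 k 2^k, which is at most 3 * 4^k because
  k \<le> k 2^k \<le> 4^k.\<close>

lemma (in fair_input) num_states_le: "num_states \<le> 2 ^ (3 * 4 ^ k)"
proof -
  have four: "(4::nat) ^ k = 2 ^ k * 2 ^ k"
    by (simp flip: power_mult_distrib)
  have k: "k \<le> 2 ^ k" "k + 1 \<le> 2 ^ k"
    using less_exp[of k] by linarith+
  have "((k + 1) ^ 2) ^ 2 ^ k \<le> ((2 ^ k) ^ 2) ^ 2 ^ k"
    using k by (intro power_mono) auto
  also have "\<dots> = 2 ^ (2 * k * 2 ^ k)"
    by (simp flip: power_mult add: mult.commute)
  finally have "num_states \<le> 2 ^ k * 2 ^ (2 * k * 2 ^ k)"
    unfolding num_states_def by (rule mult_le_mono2)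
  also have "\<dots> = 2 ^ (k + 2 * k * 2 ^ k)"
    by (simp add: power_add)
  also have "\<dots> \<le> 2 ^ (3 * 4 ^ k)"
  proof (rule power_increasing)
    have "k * 2 ^ k \<le> 4 ^ k"
      unfolding four by (rule mult_le_mono1[OF k(1)])
    moreover have "k \<le> k * 2 ^ k"
      by simp
    ultimately show "k + 2 * k * 2 ^ k \<le> 3 * 4 ^ k"
      by linarith
  qed simp
  finally show ?thesis .
qed

theorem theorem9:
  "\<exists>g :: nat \<Rightarrow> real. g \<in> O(\<lambda>k. real k) \<and>
     solvable_in_O_star
       (valid_instance :: (nat, nat) fair_instance \<Rightarrow> bool) encodes
       MaxMin_Fair_Matching_nonempty
       (\<lambda>I. card (rights I))
       (\<lambda>k. 2 powr (2 powr g k))"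
proof (intro exI[of _ "\<lambda>k. 2 * real k + 6"] conjI)
  show "(\<lambda>k. 2 * real k + 6) \<in> O(\<lambda>k. real k)"
  proof (rule bigoI[of _ 8])
    show "\<forall>\<^sub>F k in at_top. norm (2 * real k + 6) \<le> 8 * norm (real k)"
      using eventually_ge_at_top[of 1] by eventually_elim simp
  qed
  show "solvable_in_O_star (valid_instance :: (nat, nat) fair_instance \<Rightarrow> bool) encodes
      MaxMin_Fair_Matching_nonempty (\<lambda>I. card (rights I)) (\<lambda>k. 2 powr (2 powr (2 * real k + 6)))"
    unfolding solvable_in_O_star_def
  proof (intro exI[of _ prog] exI[of _ "[:100, 4:] ^ 21"] allI impI, elim conjE)
    fix I :: "(nat, nat) fair_instance" and x
    assume valid: "valid_instance I" and "encodes x I"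
    then obtain us vs es cs where us: "distinct us" "set us = lefts I"
      and vs: "distinct vs" "set vs = rights I"
      and es: "set es = {(u, v). u \<in> lefts I \<and> v \<in> rights I \<and> {u, v} \<in> edges I}"
      and cs: "distinct cs" "set cs = colors I"
      and x: "x = fair_input.code (map (\<lambda>u. (u, coloring I u)) us) vs es cs (bound I)"
      unfolding encodes_def fair_input.code_def by blast
    define k where "k = length vs"
    \<comment> \<open>The first factor dominates the number of states and 2^k + 1, the second is
      linear in the input size, so any fixed power of N splits into a function of k and a
      polynomial.\<close>
    define N where "N = 2 ^ (3 * 4 ^ k) * (4 * size x + 100)"
    interpret F: fair_input "map (\<lambda>u. (u, coloring I u)) us" vs es cs "bound I" .
    interpret F: bounded_fair_input "map (\<lambda>u. (u, coloring I u)) us" vs es cs "bound I" N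
    proof
      have "1 * 100 \<le> N"
        unfolding N_def by (intro mult_le_mono) auto
      then show "100 \<le> N"
        by simp
      have "2 ^ (3 * 4 ^ k) * 1 < N"
        unfolding N_def by (intro mult_less_mono2) auto
      then show "F.num_states < N"
        using F.num_states_le unfolding k_def by linarith
      have "k + 1 \<le> 2 ^ k"
        using less_exp[of k] by linarith
      also have "\<dots> \<le> 4 ^ k"
        by (rule power_mono) auto
      finally have "k + 1 \<le> 3 * 4 ^ k"
        by simp
      then have "(2::nat) ^ (k + 1) \<le> 2 ^ (3 * 4 ^ k)"
        by (intro power_increasing) auto
      moreover have "(2::nat) ^ k + 1 \<le> 2 ^ (k + 1)"
        by simp
      ultimately have "2 ^ k + 1 \<le> (2::nat) ^ (3 * 4 ^ k)"
        by linarith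
      then show "(2 ^ length vs + 1) * (4 * size F.code + 50) \<le> N"
        unfolding N_def x k_def by (intro mult_le_mono) auto
    qed
    \<comment> \<open>The body of the main function is within class 20; class 21 absorbs the outer
      call.\<close>
    have "evb [x] (Call 0 [Arg 0]) (enc_bool F.accepts) (cost N 21)"
      unfolding x
      by (rule evb_weaken, (rule evb_rules F.fn_main)+, use F.qs(1-20) in auto)
    then obtain t where t: "t \<le> N ^ 21" and runs: "runs prog x (enc_bool F.accepts) t"
      by (auto simp: evb_def runs_def cost_def)
    \<comment> \<open>The power N^21 has the parameter part 2^(21 * 3 * 4^k); rounding 63 up to 64 =
      2^6 gives the exponent 2k + 6.\<close>
    have "63 * 4 ^ k \<le> (2::nat) ^ (2 * k + 6)"
      by (simp add: power_add power_mult)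
    then have "N ^ 21 \<le> 2 ^ (2 ^ (2 * k + 6)) * (4 * size x + 100) ^ 21"
      unfolding N_def power_mult_distrib
      by (intro mult_le_mono1) (simp flip: power_mult add: mult.commute)
    with t have "real t \<le> real (2 ^ (2 ^ (2 * k + 6)) * (4 * size x + 100) ^ 21)"
      by (subst of_nat_le_iff) linarith
    also have "\<dots> = 2 powr (2 powr (2 * real k + 6)) * poly ([:100, 4:] ^ 21) (real (size x))"
    proof -
      have "2 powr (2 * real k + 6) = 2 ^ (2 * k + 6)"
        by (subst powr_realpow[symmetric]) auto
      moreover have "2 powr (2 ^ (2 * k + 6)) = (2::real) ^ (2 ^ (2 * k + 6))"
        by (subst powr_realpow[symmetric]) auto
      ultimately show ?thesis
        by (simp add: add.commute mult.commute)
    qed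
    also have "k = card (rights I)"
      using distinct_card[OF vs(1)] vs(2) by (simp add: k_def)
    finally have "real t \<le> 2 powr (2 powr (2 * real (card (rights I)) + 6)) *
      poly ([:100, 4:] ^ 21) (real (size x))" .
    moreover have "enc_bool F.accepts \<noteq> Null \<longleftrightarrow> MaxMin_Fair_Matching_nonempty I"
      unfolding accepts_iff_problem[OF valid us vs es cs] by (simp add: enc_bool_def)
    ultimately show "\<exists>v t. runs prog x v t \<and> (v \<noteq> Null \<longleftrightarrow> MaxMin_Fair_Matching_nonempty I) \<and>
      real t \<le> 2 powr (2 powr (2 * real (card (rights I)) + 6)) *
        poly ([:100, 4:] ^ 21) (real (size x))"
      using runs by blast
  qed
qed

end
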